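(* Let $n\ge 1$ be an integer and $0<s<1$. Let $f:\mathbb R\to\mathbb R$ and $g:[0,+\infty)\to\mathbb R$ satisfy: (F1) $f$ is strictly increasing and $\limsup_{x_1\to-\infty} f(x_1)|x_1|^{2s}\le 0$; (F2) $g$ is locally Lipschitz and nondecreasing in $(0,+\infty)$; moreover $g'(u)$ is continuous near $u=0$, $g(0)=0$, $g'(0)=0$, and $g(u)>0$ for $u\in(0,+\infty)$. Assume in addition that $f(x_1)\to+\infty$ as $x_1\to+\infty$. Then the equation $$(-\Delta)^s u(x)-\Delta u(x)=f(x_1)\,g(u(x)),\qquad x=(x_1,\dots,x_n)\in\mathbb R^n,$$ admits no positive bounded classical solution $u\in C^2(\mathbb R^n)\cap\mathcal L_{2s}$ that is uniformly continuous on $\mathbb R^n$.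
   Context: The space $\mathcal L_{2s}$ consists of functions $u:\mathbb R^n\to\mathbb R$ with $\int_{\mathbb R^n}\frac{|u(x)|}{1+|x|^{n+2s}}\,dx<+\infty$. The fractional Laplacian is $$(-\Delta)^s u(x)=C_{n,s}\lim_{\varepsilon\to0}\int_{\mathbb R^n\setminus B_\varepsilon(x)}\frac{u(x)-u(y)}{|x-y|^{n+2s}}\,dy,\qquad C_{n,s}=\frac{4^s s\,\Gamma(\frac{n+2s}{2})}{\pi^{n/2}\Gamma(1-s)}.$$ A classical solution is a function $u\in C^2(\mathbb R^n)\cap\mathcal L_{2s}$ satisfying the equation pointwise in $\mathbb R^n$. "Positive" means $u>0$ everywhere. *)

theory Defs
  imports "HOL-Analysis.Analysis"
begin

definition partially_differentiable_at :: "'n::finite \<Rightarrow> (real^'n \<Rightarrow> real) \<Rightarrow> real^'n \<Rightarrow> bool" where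
  "partially_differentiable_at i u x \<longleftrightarrow>
     (\<lambda>t::real. u (x + t *\<^sub>R axis i 1)) field_differentiable (at 0)"

definition partial_deriv :: "'n::finite \<Rightarrow> (real^'n \<Rightarrow> real) \<Rightarrow> real^'n \<Rightarrow> real" where
  "partial_deriv i u x = deriv (\<lambda>t::real. u (x + t *\<^sub>R axis i 1)) 0"

definition C2_functions :: "(real^'n::finite \<Rightarrow> real) set" where
  "C2_functions = {u. continuous_on UNIV u \<and>
     (\<forall>i. (\<forall>x. partially_differentiable_at i u x) \<and> continuous_on UNIV (partial_deriv i u)) \<and>
     (\<forall>i j. (\<forall>x. partially_differentiable_at i (partial_deriv j u) x) \<and>
            continuous_on UNIV (partial_deriv i (partial_deriv j u)))}"

definition laplacian :: "(real^'n::finite \<Rightarrow> real) \<Rightarrow> real^'n \<Rightarrow> real" where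
  "laplacian u x = (\<Sum>i\<in>UNIV. partial_deriv i (partial_deriv i u) x)"

definition L2s_space :: "real \<Rightarrow> (real^'n::finite \<Rightarrow> real) set" where
  "L2s_space s = {u. u \<in> borel_measurable lebesgue \<and>
     integrable lebesgue (\<lambda>x. \<bar>u x\<bar> / (1 + norm x powr (real CARD('n) + 2 * s)))}"

definition frac_const :: "nat \<Rightarrow> real \<Rightarrow> real" where
  "frac_const n s = 4 powr s * s * Gamma ((real n + 2 * s) / 2) /
     (pi powr (real n / 2) * Gamma (1 - s))"

definition frac_truncated_integral ::
    "real \<Rightarrow> (real^'n::finite \<Rightarrow> real) \<Rightarrow> real^'n \<Rightarrow> real \<Rightarrow> real" where
  "frac_truncated_integral s u x \<epsilon> =
     (LINT y:(UNIV - ball x \<epsilon>)|lebesgue. (u x - u y) / norm (x - y) powr (real CARD('n) + 2 * s))"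

text \<open>\<^const>\<open>Lim\<close> is total, with an unspecified value if there is no limit.
  The existence of the limit is therefore stated explicitly in the notion of classical solution
  below (for functions in C2 and L2s it always holds).\<close>

definition frac_laplacian :: "real \<Rightarrow> (real^'n::finite \<Rightarrow> real) \<Rightarrow> real^'n \<Rightarrow> real" where
  "frac_laplacian s u x =
     frac_const CARD('n) s * Lim (at_right 0) (frac_truncated_integral s u x)"

text \<open>The index \<open>k\<close> names the coordinate on which the weight \<open>f\<close> depends (the coordinate
  called x1 on paper), since a finite index type has no distinguished first element.\<close>

definition classical_solution ::
    "real \<Rightarrow> 'n::finite \<Rightarrow> (real \<Rightarrow> real) \<Rightarrow> (real \<Rightarrow> real) \<Rightarrow> (real^'n \<Rightarrow> real) \<Rightarrow> bool" where
  "classical_solution s k f g u \<longleftrightarrow>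
     u \<in> C2_functions \<and> u \<in> L2s_space s \<and>
     (\<forall>x. (\<exists>l. (frac_truncated_integral s u x \<longlongrightarrow> l) (at_right 0)) \<and>
          frac_laplacian s u x - laplacian u x = f (x $ k) * g (u x))"

definition condition_F1 :: "real \<Rightarrow> (real \<Rightarrow> real) \<Rightarrow> bool" where
  "condition_F1 s f \<longleftrightarrow> strict_mono f \<and>
     Limsup at_bot (\<lambda>t. ereal (f t * \<bar>t\<bar> powr (2 * s))) \<le> 0"

text \<open>The nonlinearity lives on the closed half line; it is represented by a total function whose
  values at negative arguments are never constrained. Hence the derivative is taken within
  \<open>{0..}\<close>, that is, it is one-sided at 0.\<close>

definition condition_F2 :: "(real \<Rightarrow> real) \<Rightarrow> bool" where
  "condition_F2 g \<longleftrightarrow>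
     (\<forall>t>0. \<exists>r>0. \<exists>L. L-lipschitz_on (cball t r \<inter> {0<..}) g) \<and>
     mono_on {0<..} g \<and>
     (\<exists>g' \<delta>. \<delta> > 0 \<and>
        (\<forall>t\<in>{0..<\<delta>}. (g has_real_derivative g' t) (at t within {0..})) \<and>
        continuous_on {0..<\<delta>} g' \<and> g' 0 = 0) \<and>
     g 0 = 0 \<and> (\<forall>t>0. g t > 0)"

end

theory Submission
  imports Defs
begin

text \<open>Write \<open>L u\<close> for the fractional Laplacian of \<open>u\<close> minus its Laplacian, so that the equation reads
\<open>L u = f(x\<^sub>k) g(u)\<close>, and let \<open>e\<close> be the unit vector in direction \<open>k\<close>. There are two steps: a
solution must be nondecreasing along \<open>e\<close>, and a positive solution that is nondecreasing along \<open>e\<close>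
cannot be bounded, because then \<open>L u\<close> would have to be arbitrarily large on far away balls of fixed
size.

For the monotonicity, planes are moved from the far left. Let \<open>w = u \<circ> R - u\<close>, where \<open>R\<close> is the
reflection at the plane \<open>x\<^sub>k = \<nu>\<close>, and suppose that the infimum \<open>-m\<close> of \<open>w\<close> over the half space
\<open>x\<^sub>k < \<nu>\<close> is negative. The half space is unbounded and the infimum need not be attained. But if \<open>p\<close>
nearly attains it, then adding to \<open>w\<close> a small multiple of \<open>|x - p|\<^sup>2 / r\<^sup>2\<close>, with \<open>r\<close> comparable to the
larger of 1 and the distance of \<open>p\<close> from the plane, moves the minimum to some point \<open>x\<close> of a compact
set. There \<open>w\<close> is touched from below by a paraboloid, which controls the Laplacian, and since \<open>w\<close>
is antisymmetric, pairing each point with its mirror image in the singular integral yields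
\<open>L w(x) \<le> - c m d\<^bsup>-2s\<^esup>\<close>, where \<open>d\<close> is the distance of \<open>x\<close> from the plane and \<open>c\<close> depends only on the
dimension and on \<open>s\<close> (lemma \<open>mixed_operator_reflection_near_minimum\<close>). The equation gives
\<open>L w(x) = [f(2\<nu> - x\<^sub>k) - f(x\<^sub>k)] g(u(R x)) + f(x\<^sub>k) [g(u(R x)) - g(u(x))]\<close>, whose first summand is
positive. Hence \<open>f(x\<^sub>k) > 0\<close>, and \<open>c d\<^bsup>-2s\<^esup>\<close> is at most \<open>f(x\<^sub>k)\<close> times a Lipschitz constant of \<open>g\<close>.
By the decay of \<open>f\<close> at \<open>-\<infinity>\<close> this keeps \<open>x\<^sub>k\<close> away from \<open>-\<infinity>\<close>, so that no such infimum exists when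
\<open>\<nu>\<close> is very negative.

If the planes had to stop at a last position \<open>\<mu>\<close>, there would be positions \<open>\<nu>\<close> slightly beyond \<open>\<mu>\<close>
with negative infimum, and uniform continuity would force \<open>m\<close> to be as small as desired. The same
estimates bound \<open>d\<close> from above and away from 0. Therefore the jump \<open>f(2\<nu> - x\<^sub>k) - f(x\<^sub>k)\<close> is bounded
below, hence \<open>g(u(R x))\<close> is small, hence \<open>u\<close> is small at \<open>x\<close> and at \<open>R x\<close>, where the difference
quotients of \<open>g\<close> are small since \<open>g'(0) = 0\<close>; this contradicts \<open>L w(x) \<le> - c m d\<^bsup>-2s\<^esup>\<close>. All this is
quantitative, and no limit of translated solutions is taken (lemma \<open>order_extends_to_the_right\<close>).

For the second step, adding a paraboloid to \<open>u\<close> shows that every unit ball contains a point where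
\<open>L u\<close> is below a fixed constant (lemma \<open>mixed_operator_bounded_above_on_unit_balls\<close>). By
monotonicity \<open>u\<close> is bounded below by one positive constant on all balls centred at \<open>t e\<close> with
\<open>t \<ge> 0\<close>, so \<open>L u = f g(u)\<close> tends to infinity on these balls as \<open>t \<rightarrow> \<infinity>\<close>.\<close>

section \<open>The kernel of the fractional Laplacian\<close>

definition riesz_kernel :: "real \<Rightarrow> real^'n::finite \<Rightarrow> real" where
  "riesz_kernel s z = norm z powr - (real CARD('n) + 2 * s)"

lemma riesz_kernel_nonneg [simp]: "0 \<le> riesz_kernel s z"
  by (simp add: riesz_kernel_def)

lemma riesz_kernel_uminus [simp]: "riesz_kernel s (- z) = riesz_kernel s z"
  by (simp add: riesz_kernel_def)

lemma borel_measurable_riesz_kernel [measurable]: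
  "riesz_kernel s \<in> borel_measurable borel"
  unfolding riesz_kernel_def by measurable

text \<open>Polar coordinates are avoided: both radial integrals below are estimated on dyadic shells, and each
shell is enlarged to the ball inside its outer sphere. The contributions then form a geometric series.\<close>

lemma integral_le_geometric_ball_cover:
  fixes \<phi> :: "'a::euclidean_space \<Rightarrow> real" and \<rho> v :: "nat \<Rightarrow> real"
  assumes [measurable]: "\<phi> \<in> borel_measurable borel"
    and nonneg: "\<And>z. 0 \<le> \<phi> z"
    and cover: "\<And>z. \<phi> z \<noteq> 0 \<Longrightarrow> \<exists>j. norm z < \<rho> j \<and> \<phi> z \<le> v j"
    and v: "\<And>j. 0 \<le> v j" and \<rho>: "\<And>j. 0 \<le> \<rho> j"
    and mass: "\<And>j. v j * (unit_ball_vol DIM('a) * \<rho> j ^ DIM('a)) = c * q ^ j"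
    and q: "0 \<le> q" "q < 1"
  shows "integrable lborel \<phi> \<and> (LINT z|lborel. \<phi> z) \<le> c / (1 - q)"
proof -
  have c: "0 \<le> c"
    using mass[of 0] v[of 0] \<rho>[of 0] unit_ball_vol_nonneg[of "DIM('a)"] by (metis mult.right_neutral mult_nonneg_nonneg power_0 zero_le_power of_nat_0_le_iff)
  have [measurable]: "ball (0::'a) r \<in> sets borel" for r by simp
  have pt: "ennreal (\<phi> z) \<le> (\<Sum>j. ennreal (v j) * indicator (ball (0::'a) (\<rho> j)) z)" for z
  proof (cases "\<phi> z = 0")
    case False
    then obtain j where j: "norm z < \<rho> j" "\<phi> z \<le> v j" using cover by blast
    have "ennreal (\<phi> z) \<le> ennreal (v j) * indicator (ball (0::'a) (\<rho> j)) z"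
      using j by (simp add: ennreal_leI)
    also have "\<dots> = sum (\<lambda>i. ennreal (v i) * indicator (ball 0 (\<rho> i)) z) {j}" by (simp only: sum.insert sum.empty finite.emptyI empty_iff add_0_right not_False_eq_True)
    also have "\<dots> \<le> (\<Sum>j. ennreal (v j) * indicator (ball (0::'a) (\<rho> j)) z)"
      by (rule sum_le_suminf) auto
    finally show ?thesis .
  qed simp
  have "(\<integral>\<^sup>+z. ennreal (\<phi> z) \<partial>lborel) \<le> (\<integral>\<^sup>+z. (\<Sum>j. ennreal (v j) * indicator (ball (0::'a) (\<rho> j)) z) \<partial>lborel)"
    by (rule nn_integral_mono) (rule pt)
  also have "\<dots> = (\<Sum>j. \<integral>\<^sup>+z. ennreal (v j) * indicator (ball (0::'a) (\<rho> j)) z \<partial>lborel)"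
    by (rule nn_integral_suminf) measurable
  also have "\<dots> = (\<Sum>j. ennreal (c * q ^ j))"
  proof (rule suminf_cong)
    fix j
    have "(\<integral>\<^sup>+z. ennreal (v j) * indicator (ball (0::'a) (\<rho> j)) z \<partial>lborel) = ennreal (v j) * emeasure lborel (ball (0::'a) (\<rho> j))"
      by (rule nn_integral_cmult_indicator) simp
    also have "\<dots> = ennreal (c * q ^ j)"
      using \<rho>[of j] v[of j] by (simp add: emeasure_ball ennreal_mult'[symmetric] mass)
    finally show "(\<integral>\<^sup>+z. ennreal (v j) * indicator (ball (0::'a) (\<rho> j)) z \<partial>lborel) = ennreal (c * q ^ j)" .
  qed
  also have "\<dots> = ennreal (\<Sum>j. c * q ^ j)"
    using c q by (intro suminf_ennreal2 summable_mult summable_geometric) auto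
  also have "(\<Sum>j. c * q ^ j) = c / (1 - q)"
    using q by (simp add: suminf_mult suminf_geometric summable_geometric)
  finally have le: "(\<integral>\<^sup>+z. ennreal (\<phi> z) \<partial>lborel) \<le> ennreal (c / (1 - q))" .
  have int: "integrable lborel \<phi>"
    using le nonneg by (intro integrableI_bounded) (auto intro: le_less_trans)
  moreover have "(LINT z|lborel. \<phi> z) \<le> c / (1 - q)"
    using le c q nonneg int by (subst (asm) nn_integral_eq_integral) auto
  ultimately show ?thesis by simp
qed

lemma dyadic_shell_outer:
  fixes d t :: real
  assumes "0 < d" "d \<le> t"
  shows "\<exists>j::nat. 2 ^ j * d \<le> t \<and> t < 2 ^ Suc j * d"
proof -
  obtain i :: nat where i: "t / d < 2 ^ i" using real_arch_pow[of 2 "t / d"] by auto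
  define m where "m = (LEAST i. t / d < (2::real) ^ i)"
  have m: "t / d < 2 ^ m" unfolding m_def by (rule LeastI[of _ i]) (rule i)
  have "m \<noteq> 0" using m assms by (cases "m = 0") (auto simp: field_simps)
  then obtain j where j: "m = Suc j" by (cases m) auto
  have "\<not> t / d < 2 ^ j" using not_less_Least[of j "\<lambda>i. t / d < (2::real) ^ i"] j unfolding m_def by simp
  then show ?thesis using m j assms by (intro exI[of _ j]) (auto simp: field_simps)
qed

lemma dyadic_shell_inner:
  fixes d t :: real
  assumes "0 < t" "t < d"
  shows "\<exists>j::nat. (1/2) ^ Suc j * d \<le> t \<and> t < (1/2) ^ j * d"
proof -
  obtain i :: nat where i: "(1/2) ^ i < t / d" using real_arch_pow_inv[of "t / d" "1/2"] assms by auto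
  define m where "m = (LEAST i. ((1/2)::real) ^ i \<le> t / d)"
  have m: "(1/2) ^ m \<le> t / d" unfolding m_def by (rule LeastI[of _ i]) (use i in simp)
  have "m \<noteq> 0" using m assms by (cases "m = 0") (auto simp: field_simps)
  then obtain j where j: "m = Suc j" by (cases m) auto
  have "\<not> (1/2) ^ j \<le> t / d" using not_less_Least[of j "\<lambda>i. ((1/2)::real) ^ i \<le> t / d"] j unfolding m_def by simp
  then show ?thesis using m j assms by (intro exI[of _ j]) (auto simp: field_simps)
qed

text \<open>On the shell \<open>2\<^sup>j d \<le> |z| < 2\<^bsup>j+1\<^esup> d\<close> the kernel has size \<open>(2\<^sup>j d)\<^bsup>-n-2s\<^esup>\<close> and the volume is of order
\<open>(2\<^sup>j d)\<^sup>n\<close>, so the ratio of the series is \<open>2\<^bsup>-2s\<^esup> < 1\<close>.\<close>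

lemma riesz_kernel_tail:
  fixes d s :: real
  assumes "0 < s" "0 < d"
  defines "\<phi> \<equiv> \<lambda>z::real^'n::finite. indicator {z. d \<le> norm z} z * riesz_kernel s z"
  shows "integrable lborel \<phi> \<and>
    (LINT z|lborel. \<phi> z) \<le> unit_ball_vol CARD('n) * 2 ^ CARD('n) / (1 - 2 powr (- 2 * s)) * d powr (- 2 * s)"
proof -
  let ?n = "CARD('n)"
  let ?p = "real ?n + 2 * s"
  have "integrable lborel \<phi> \<and>
    (LINT z|lborel. \<phi> z) \<le> (unit_ball_vol ?n * 2 ^ ?n * d powr (- 2 * s)) / (1 - 2 powr (- 2 * s))"
  proof (rule integral_le_geometric_ball_cover[where \<rho> = "\<lambda>j. 2 ^ Suc j * d" and v = "\<lambda>j. (2 ^ j * d) powr - ?p"])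
    show "\<phi> \<in> borel_measurable borel" unfolding \<phi>_def by measurable
    show "\<And>z. 0 \<le> \<phi> z" by (simp add: \<phi>_def)
    show "\<exists>j. norm z < 2 ^ Suc j * d \<and> \<phi> z \<le> (2 ^ j * d) powr - ?p" if "\<phi> z \<noteq> 0" for z
    proof -
      have "d \<le> norm z" using that by (auto simp: \<phi>_def indicator_def split: if_splits)
      then obtain j :: nat where j: "2 ^ j * d \<le> norm z" "norm z < 2 ^ Suc j * d"
        using dyadic_shell_outer assms(2) by blast
      have "\<phi> z \<le> (2 ^ j * d) powr - ?p"
        using j assms \<open>d \<le> norm z\<close> by (simp add: \<phi>_def riesz_kernel_def powr_mono2')
      then show ?thesis using j by blast
    qed
    show "(2 ^ j * d) powr - ?p * (unit_ball_vol (real DIM(real^'n)) * (2 ^ Suc j * d) ^ DIM(real^'n)) =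
        unit_ball_vol ?n * 2 ^ ?n * d powr (- 2 * s) * (2 powr (- 2 * s)) ^ j" for j
    proof -
      have "(2 ^ j * d) powr - ?p * (2 ^ Suc j * d) ^ ?n = 2 ^ ?n * ((2 ^ j * d) powr - ?p * (2 ^ j * d) powr ?n)"
        using assms by (simp add: powr_realpow power_mult_distrib mult_ac)
      also have "(2 ^ j * d) powr - ?p * (2 ^ j * d) powr ?n = (2 ^ j * d) powr (- 2 * s)"
        by (simp add: powr_add[symmetric])
      also have "\<dots> = d powr (- 2 * s) * (2 powr (- 2 * s)) ^ j"
        using assms by (simp add: powr_mult powr_realpow[symmetric] powr_powr mult_ac)
      finally show ?thesis by (simp add: mult_ac)
    qed
    show "2 powr (- 2 * s) < 1" using assms by (simp add: powr_less_one)
  qed (use assms in auto)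
  then show ?thesis by (simp add: field_simps)
qed

text \<open>Two powers of \<open>|z|\<close> compensate the singularity because \<open>s < 1\<close>: the ratio of the series is now
\<open>2\<^bsup>2s-2\<^esup> < 1\<close>.\<close>

lemma riesz_kernel_second_moment:
  fixes d s :: real
  assumes "0 < s" "s < 1" "0 < d"
  defines "\<phi> \<equiv> \<lambda>z::real^'n::finite. indicator {z. norm z < d} z * ((norm z)\<^sup>2 * riesz_kernel s z)"
  shows "integrable lborel \<phi> \<and>
    (LINT z|lborel. \<phi> z) \<le> unit_ball_vol CARD('n) * 2 powr (real CARD('n) + 2 * s) / (1 - 2 powr (2 * s - 2)) * d powr (2 - 2 * s)"
proof -
  let ?n = "CARD('n)"
  let ?p = "real ?n + 2 * s"
  have "integrable lborel \<phi> \<and>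
    (LINT z|lborel. \<phi> z) \<le> (unit_ball_vol ?n * 2 powr ?p * d powr (2 - 2 * s)) / (1 - 2 powr (2 * s - 2))"
  proof (rule integral_le_geometric_ball_cover[where \<rho> = "\<lambda>j. (1/2) ^ j * d"
        and v = "\<lambda>j. ((1/2) ^ j * d)\<^sup>2 * ((1/2) ^ Suc j * d) powr - ?p"])
    show "\<phi> \<in> borel_measurable borel" unfolding \<phi>_def by measurable
    show "\<And>z. 0 \<le> \<phi> z" by (simp add: \<phi>_def)
    show "\<exists>j. norm z < (1/2) ^ j * d \<and> \<phi> z \<le> ((1/2) ^ j * d)\<^sup>2 * ((1/2) ^ Suc j * d) powr - ?p" if "\<phi> z \<noteq> 0" for z
    proof -
      have z: "norm z < d" "0 < norm z" using that by (auto simp: \<phi>_def indicator_def split: if_splits)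
      then obtain j :: nat where j: "(1/2) ^ Suc j * d \<le> norm z" "norm z < (1/2) ^ j * d"
        using dyadic_shell_inner by blast
      have "(norm z)\<^sup>2 * norm z powr - ?p \<le> ((1/2) ^ j * d)\<^sup>2 * ((1/2) ^ Suc j * d) powr - ?p"
        using j assms z by (intro mult_mono power_mono powr_mono2') auto
      then have "\<phi> z \<le> ((1/2) ^ j * d)\<^sup>2 * ((1/2) ^ Suc j * d) powr - ?p"
        using z by (simp add: \<phi>_def riesz_kernel_def)
      then show ?thesis using j by blast
    qed
    show "((1/2) ^ j * d)\<^sup>2 * ((1/2) ^ Suc j * d) powr - ?p * (unit_ball_vol (real DIM(real^'n)) * ((1/2) ^ j * d) ^ DIM(real^'n)) =
        unit_ball_vol ?n * 2 powr ?p * d powr (2 - 2 * s) * (2 powr (2 * s - 2)) ^ j" for j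
    proof -
      define e where "e = (1/2) ^ j * d"
      have e: "0 < e" using assms by (simp add: e_def)
      have "((1/2) ^ Suc j * d) powr - ?p = (e * (1/2)) powr - ?p" by (simp add: e_def mult_ac)
      also have "\<dots> = e powr - ?p * 2 powr ?p"
      proof -
        have "(1/2 :: real) powr - ?p = 2 powr ?p"
          unfolding powr_minus[of "1/2" ?p] by (simp add: powr_divide)
        then show ?thesis using e by (simp only: powr_mult)
      qed
      finally have "e\<^sup>2 * ((1/2) ^ Suc j * d) powr - ?p * e ^ ?n = 2 powr ?p * (e powr 2 * e powr - ?p * e powr ?n)"
        using e by (simp add: powr_realpow)
      also have "e powr 2 * e powr - ?p * e powr ?n = e powr (2 - 2 * s)"
        by (simp add: powr_add[symmetric])
      also have "\<dots> = ((1/2) powr (2 - 2 * s)) ^ j * d powr (2 - 2 * s)"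
        using assms by (simp add: e_def powr_mult powr_realpow[symmetric] powr_powr mult_ac)
      also have "(1/2) powr (2 - 2 * s) = 2 powr (2 * s - 2)"
        using powr_minus_divide[of 2 "2 - 2 * s"] by (simp add: powr_divide)
      finally show ?thesis by (simp add: mult_ac e_def)
    qed
    show "2 powr (2 * s - 2) < 1" using assms by (simp add: powr_less_one)
  qed (use assms in auto)
  then show ?thesis by (simp add: field_simps)
qed

lemma riesz_kernel_moments:
  assumes "0 < s" "s < 1"
  obtains C where "0 < C"
    and "\<And>d. 0 < d \<Longrightarrow> integrable lborel (\<lambda>z::real^'n::finite. indicator {z. d \<le> norm z} z * riesz_kernel s z)"
    and "\<And>d. 0 < d \<Longrightarrow> (LINT z::real^'n|lborel. indicator {z. d \<le> norm z} z * riesz_kernel s z) \<le> C * d powr (- 2 * s)"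
    and "\<And>d. 0 < d \<Longrightarrow> integrable lborel (\<lambda>z::real^'n. indicator {z. norm z < d} z * ((norm z)\<^sup>2 * riesz_kernel s z))"
    and "\<And>d. 0 < d \<Longrightarrow> (LINT z::real^'n|lborel. indicator {z. norm z < d} z * ((norm z)\<^sup>2 * riesz_kernel s z)) \<le> C * d powr (2 - 2 * s)"
proof -
  let ?A = "unit_ball_vol CARD('n) * 2 ^ CARD('n) / (1 - 2 powr (- 2 * s))"
  let ?B = "unit_ball_vol CARD('n) * 2 powr (real CARD('n) + 2 * s) / (1 - 2 powr (2 * s - 2))"
  have q: "2 powr (- 2 * s) < 1" "2 powr (2 * s - 2) < 1" using assms by (auto simp: powr_less_one)
  have A: "0 < ?A" using q by (intro divide_pos_pos mult_pos_pos) (auto)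
  have B: "0 < ?B" using q by (intro divide_pos_pos mult_pos_pos) (auto)
  have mono: "X * d powr e \<le> (?A + ?B) * d powr e" if "X \<in> {?A, ?B}" for X d e :: real
    using that A B by (intro mult_right_mono) auto
  show ?thesis
  proof (rule that[of "?A + ?B"])
    show "0 < ?A + ?B" using A B by simp
    fix d :: real assume d: "0 < d"
    show "integrable lborel (\<lambda>z::real^'n::finite. indicator {z. d \<le> norm z} z * riesz_kernel s z)"
      using riesz_kernel_tail[of s d] assms d by blast
    show "(LINT z::real^'n|lborel. indicator {z. d \<le> norm z} z * riesz_kernel s z) \<le> (?A + ?B) * d powr (- 2 * s)"
      using riesz_kernel_tail[of s d, where 'n='n] assms d mono[of ?A d "- 2 * s"] by (auto intro: order_trans)
    show "integrable lborel (\<lambda>z::real^'n. indicator {z. norm z < d} z * ((norm z)\<^sup>2 * riesz_kernel s z))"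
      using riesz_kernel_second_moment[of s d] assms d by blast
    show "(LINT z::real^'n|lborel. indicator {z. norm z < d} z * ((norm z)\<^sup>2 * riesz_kernel s z)) \<le> (?A + ?B) * d powr (2 - 2 * s)"
      using riesz_kernel_second_moment[of s d, where 'n='n] assms d mono[of ?B d "2 - 2 * s"] by (auto intro: order_trans)
  qed
qed

section \<open>Reflections at hyperplanes\<close>

definition reflect :: "'n::finite \<Rightarrow> real \<Rightarrow> real^'n \<Rightarrow> real^'n" where
  "reflect k c z = z + (2 * (c - z $ k)) *\<^sub>R axis k 1"

lemma reflect_nth: "reflect k c z $ i = (if i = k then 2 * c - z $ k else z $ i)"
  by (simp add: reflect_def axis_def)

lemma reflect_reflect [simp]: "reflect k c (reflect k c z) = z"
  by (simp add: vec_eq_iff reflect_nth)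

lemma reflect_add: "reflect k c (x + z) = reflect k c x + reflect k 0 z"
  by (simp add: vec_eq_iff reflect_nth)

lemma continuous_on_reflect [continuous_intros]:
  "continuous_on S (reflect k c)"
  unfolding reflect_def by (intro continuous_intros)

lemma borel_measurable_reflect [measurable]: "reflect k c \<in> borel_measurable borel"
  by (intro borel_measurable_continuous_onI continuous_on_reflect)

lemma norm_reflect_power2: "(norm (reflect k c z))\<^sup>2 = (norm z)\<^sup>2 + 4 * c * (c - z $ k)"
proof -
  have "(norm (reflect k c z))\<^sup>2 = reflect k c z \<bullet> reflect k c z" by (simp add: power2_norm_eq_inner)
  also have "\<dots> = z \<bullet> z + 4 * c * (c - z $ k)"
    by (simp add: reflect_def inner_add_left inner_add_right inner_axis inner_axis' inner_axis_axis algebra_simps power2_eq_square)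
  finally show ?thesis by (simp add: power2_norm_eq_inner)
qed

lemma norm_reflect_0 [simp]: "norm (reflect k 0 z) = norm z"
  using norm_reflect_power2[of k 0 z] by simp

lemma lborel_distr_reflect: "distr lborel borel (reflect k c) = (lborel :: (real^'n::finite) measure)"
proof -
  define \<sigma> :: "real^'n \<Rightarrow> real" where "\<sigma> j = (if j = axis k 1 then - 1 else 1)" for j
  have k: "axis k (1::real) \<in> (Basis :: (real^'n) set)" by (simp add: axis_in_Basis_iff)
  have T: "(\<lambda>x. (2 * c) *\<^sub>R axis k 1 + (\<Sum>j\<in>Basis. (\<sigma> j * (x \<bullet> j)) *\<^sub>R j)) = reflect k c"
  proof
    fix x :: "real^'n"
    have "(\<Sum>j\<in>Basis. (\<sigma> j * (x \<bullet> j)) *\<^sub>R j) =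
        (\<Sum>j\<in>Basis. (x \<bullet> j) *\<^sub>R j - (if j = axis k 1 then (2 * (x \<bullet> j)) *\<^sub>R j else 0))"
      by (intro sum.cong refl) (simp add: \<sigma>_def scaleR_left_diff_distrib[symmetric])
    also have "\<dots> = x - (2 * x $ k) *\<^sub>R axis k 1"
      using k by (simp add: sum_subtractf euclidean_representation inner_axis)
    finally show "(2 * c) *\<^sub>R axis k 1 + (\<Sum>j\<in>Basis. (\<sigma> j * (x \<bullet> j)) *\<^sub>R j) = reflect k c x"
      by (simp add: reflect_def algebra_simps)
  qed
  have "\<bar>\<sigma> j\<bar> = 1" for j by (simp add: \<sigma>_def)
  then have one: "(\<Prod>j\<in>Basis. \<bar>\<sigma> j\<bar>) = 1" by simp
  have "(lborel :: (real^'n) measure) = density (distr lborel borel (reflect k c)) (\<lambda>_. (\<Prod>j\<in>Basis. \<bar>\<sigma> j\<bar>))"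
    using lborel_affine_euclidean[of \<sigma> "(2 * c) *\<^sub>R axis k 1"] unfolding T by (simp add: \<sigma>_def)
  then show ?thesis by (simp add: one density_1)
qed

lemma lborel_integral_reflect:
  fixes f :: "real^'n::finite \<Rightarrow> real"
  assumes [measurable]: "f \<in> borel_measurable borel"
  shows "(LINT z|lborel. f (reflect k c z)) = (LINT z|lborel. f z)"
proof -
  have "(LINT z|lborel. f z) = (LINT z|distr lborel borel (reflect k c). f z)"
    by (simp add: lborel_distr_reflect)
  also have "\<dots> = (LINT z|lborel. f (reflect k c z))" by (rule integral_distr) auto
  finally show ?thesis by simp
qed

lemma lborel_integrable_reflect:
  fixes f :: "real^'n::finite \<Rightarrow> real"
  assumes "integrable lborel f"
  shows "integrable lborel (\<lambda>z. f (reflect k c z))"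
proof -
  have "integrable (distr lborel borel (reflect k c)) f" using assms by (simp add: lborel_distr_reflect)
  then show ?thesis by (rule integrable_distr[rotated]) simp
qed

lemma lborel_distr_uminus_euclidean: "distr lborel borel uminus = (lborel :: 'a::euclidean_space measure)"
proof -
  have "lborel = density (distr lborel borel (\<lambda>x::'a. 0 + (- 1) *\<^sub>R x)) (\<lambda>_. ennreal (\<bar>- 1\<bar> ^ DIM('a)))"
    using lborel_affine[of "- 1" "0::'a"] by simp
  then have "lborel = density (distr lborel borel (\<lambda>x::'a. - x)) (\<lambda>_. 1)" by simp
  then show ?thesis by (simp add: density_1)
qed

lemma lborel_integral_uminus:
  fixes f :: "'a::euclidean_space \<Rightarrow> real"
  assumes [measurable]: "f \<in> borel_measurable borel"
  shows "(LINT z|lborel. f (- z)) = (LINT z|lborel. f z)"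
proof -
  have "(LINT z|lborel. f z) = (LINT z|distr lborel borel uminus. f z)"
    by (simp add: lborel_distr_uminus_euclidean)
  also have "\<dots> = (LINT z|lborel. f (- z))" by (rule integral_distr) auto
  finally show ?thesis by simp
qed

lemma lborel_integrable_uminus:
  fixes f :: "'a::euclidean_space \<Rightarrow> real"
  assumes "integrable lborel f"
  shows "integrable lborel (\<lambda>z. f (- z))"
proof -
  have "integrable (distr lborel borel uminus) f" using assms by (simp add: lborel_distr_uminus_euclidean)
  then show ?thesis by (rule integrable_distr[rotated]) simp
qed

section \<open>Truncated singular integrals\<close>

text \<open>The truncated integral of the fractional Laplacian at \<open>x\<close>, recentred at the origin: it is applied to
\<open>h z = u x - u (x + z)\<close>.\<close>

definition kernel_integral :: "real \<Rightarrow> real \<Rightarrow> (real^'n::finite \<Rightarrow> real) \<Rightarrow> real" where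
  "kernel_integral s e h = (LINT z|lborel. indicator {z. e \<le> norm z} z * (h z * riesz_kernel s z))"

lemma integrable_truncated_kernel:
  fixes h :: "real^'n::finite \<Rightarrow> real"
  assumes "0 < s" "0 < e" and [measurable]: "h \<in> borel_measurable borel" and "bounded (range h)"
  shows "integrable lborel (\<lambda>z. indicator {z. e \<le> norm z} z * (h z * riesz_kernel s z))"
proof -
  obtain B where B: "\<And>z. \<bar>h z\<bar> \<le> B" using assms(4) by (auto simp: bounded_iff)
  have "0 \<le> B" using B[of 0] by simp
  show ?thesis
  proof (rule Bochner_Integration.integrable_bound)
    show "integrable lborel (\<lambda>z::real^'n. B * (indicator {z. e \<le> norm z} z * riesz_kernel s z))"
      using riesz_kernel_tail[OF assms(1,2), where 'n='n] by simp
    show "AE z in lborel. norm (indicator {z. e \<le> norm z} z * (h z * riesz_kernel s z))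
      \<le> norm (B * (indicator {z::real^'n. e \<le> norm z} z * riesz_kernel s z))"
      using B \<open>0 \<le> B\<close> by (intro AE_I2) (auto simp: abs_mult indicator_def intro!: mult_right_mono)
  qed measurable
qed

lemma kernel_integral_diff:
  assumes "0 < s" "0 < e" "h \<in> borel_measurable borel" "bounded (range h)"
    "h' \<in> borel_measurable borel" "bounded (range h')"
  shows "kernel_integral s e (\<lambda>z. h z - h' z) = kernel_integral s e h - kernel_integral s e h'"
proof -
  have "kernel_integral s e (\<lambda>z. h z - h' z) = (LINT z|lborel. indicator {z. e \<le> norm z} z * (h z * riesz_kernel s z)
      - indicator {z. e \<le> norm z} z * (h' z * riesz_kernel s z))"
    unfolding kernel_integral_def by (simp add: algebra_simps)
  also have "\<dots> = kernel_integral s e h - kernel_integral s e h'"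
    unfolding kernel_integral_def using assms
    by (intro Bochner_Integration.integral_diff integrable_truncated_kernel) auto
  finally show ?thesis .
qed

lemma kernel_integral_reflect_0:
  assumes [measurable]: "h \<in> borel_measurable borel"
  shows "kernel_integral s e (\<lambda>z. h (reflect k 0 z)) = kernel_integral s e h"
proof -
  have "kernel_integral s e (\<lambda>z. h (reflect k 0 z)) =
    (LINT z|lborel. (\<lambda>z. indicator {z. e \<le> norm z} z * (h z * riesz_kernel s z)) (reflect k 0 z))"
    unfolding kernel_integral_def by (simp add: riesz_kernel_def indicator_def)
  also have "\<dots> = kernel_integral s e h"
    unfolding kernel_integral_def by (rule lborel_integral_reflect) measurable
  finally show ?thesis .
qed

lemma frac_truncated_integral_eq_kernel_integral:
  fixes u :: "real^'n::finite \<Rightarrow> real"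
  assumes "continuous_on UNIV u"
  shows "frac_truncated_integral s u x e = kernel_integral s e (\<lambda>z. u x - u (x + z))"
proof -
  have [measurable]: "u \<in> borel_measurable borel" using assms by (rule borel_measurable_continuous_onI)
  define \<phi> where "\<phi> = (\<lambda>y. indicator (UNIV - ball x e) y * ((u x - u y) / norm (x - y) powr (real CARD('n) + 2 * s)))"
  have [measurable]: "ball x e \<in> sets borel" by simp
  have [measurable]: "\<phi> \<in> borel_measurable borel" unfolding \<phi>_def by measurable
  have "frac_truncated_integral s u x e = (LINT y|lebesgue. \<phi> y)"
    unfolding frac_truncated_integral_def set_lebesgue_integral_def \<phi>_def by simp
  also have "\<dots> = (LINT y|lborel. \<phi> y)" by (rule integral_completion) simp
  also have "\<dots> = (LINT y|distr lborel borel ((+) x). \<phi> y)" by (simp add: lborel_distr_plus)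
  also have "\<dots> = (LINT z|lborel. \<phi> (x + z))" by (rule integral_distr) auto
  also have "\<dots> = kernel_integral s e (\<lambda>z. u x - u (x + z))"
    unfolding kernel_integral_def
    by (intro Bochner_Integration.integral_cong refl)
       (auto simp: \<phi>_def riesz_kernel_def indicator_def dist_norm
         powr_minus_divide[of _ "real CARD('n) + 2 * s", simplified])
  finally show ?thesis .
qed

text \<open>Since the kernel is even, only the even part of \<open>h\<close> counts. Near the origin it is quadratically
small, so the bound does not depend on the truncation radius \<open>e\<close> and survives the limit \<open>e \<rightarrow> 0\<close>.\<close>

lemma kernel_integral_le:
  assumes "0 < s" "s < 1"
  obtains C where "0 < C"
    and "\<And>d a B e (h :: real^'n::finite \<Rightarrow> real). \<lbrakk>0 < d; 0 \<le> a; 0 \<le> B; 0 < e; h \<in> borel_measurable borel; bounded (range h);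
       \<And>z. norm z < d \<Longrightarrow> h z + h (- z) \<le> 2 * a * (norm z)\<^sup>2; \<And>z. d \<le> norm z \<Longrightarrow> h z \<le> B\<rbrakk>
       \<Longrightarrow> kernel_integral s e h \<le> C * (a * d powr (2 - 2 * s) + B * d powr (- 2 * s))"
proof -
  obtain C where C: "0 < C"
    and tail_int: "\<And>d. 0 < d \<Longrightarrow> integrable lborel (\<lambda>z::real^'n::finite. indicator {z. d \<le> norm z} z * riesz_kernel s z)"
    and tail: "\<And>d. 0 < d \<Longrightarrow> (LINT z::real^'n|lborel. indicator {z. d \<le> norm z} z * riesz_kernel s z) \<le> C * d powr (- 2 * s)"
    and mom_int: "\<And>d. 0 < d \<Longrightarrow> integrable lborel (\<lambda>z::real^'n. indicator {z. norm z < d} z * ((norm z)\<^sup>2 * riesz_kernel s z))"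
    and mom: "\<And>d. 0 < d \<Longrightarrow> (LINT z::real^'n|lborel. indicator {z. norm z < d} z * ((norm z)\<^sup>2 * riesz_kernel s z)) \<le> C * d powr (2 - 2 * s)"
    using riesz_kernel_moments[OF assms, where 'n='n] by blast
  show ?thesis
  proof (rule that[OF C])
    fix d a B e :: real and h :: "real^'n \<Rightarrow> real"
    assume d: "0 < d" and a: "0 \<le> a" and B: "0 \<le> B" and e: "0 < e"
      and [measurable]: "h \<in> borel_measurable borel" and bdd: "bounded (range h)"
      and near: "\<And>z. norm z < d \<Longrightarrow> h z + h (- z) \<le> 2 * a * (norm z)\<^sup>2"
      and far: "\<And>z. d \<le> norm z \<Longrightarrow> h z \<le> B"
    define G where "G z = indicator {z. e \<le> norm z} z * (h z * riesz_kernel s z)" for z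
    have [measurable]: "G \<in> borel_measurable borel" unfolding G_def[abs_def] by measurable
    have G: "integrable lborel G"
      unfolding G_def[abs_def] using integrable_truncated_kernel[OF assms(1) e _ bdd] by simp
    define N where "N z = indicator {z. norm z < d} z * ((norm z)\<^sup>2 * riesz_kernel s z)" for z :: "real^'n"
    define F where "F z = indicator {z. d \<le> norm z} z * riesz_kernel s z" for z :: "real^'n"
    have N: "integrable lborel N" "(LINT z|lborel. N z) \<le> C * d powr (2 - 2 * s)"
      using mom_int[OF d] mom[OF d] by (simp_all add: N_def[abs_def])
    have F: "integrable lborel F" "(LINT z|lborel. F z) \<le> C * d powr (- 2 * s)"
      using tail_int[OF d] tail[OF d] by (simp_all add: F_def[abs_def])
    have pt: "G z + G (- z) \<le> 2 * a * N z + 2 * B * F z" for z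
    proof (cases "e \<le> norm z")
      case True
      then have eq: "G z + G (- z) = (h z + h (- z)) * riesz_kernel s z"
        by (simp add: G_def algebra_simps)
      show ?thesis
      proof (cases "norm z < d")
        case True
        have "(h z + h (- z)) * riesz_kernel s z \<le> (2 * a * (norm z)\<^sup>2) * riesz_kernel s z"
          by (intro mult_right_mono near True) simp
        then show ?thesis unfolding eq using True by (simp add: N_def F_def)
      next
        case False
        then have "h z + h (- z) \<le> 2 * B" using far[of z] far[of "- z"] by simp
        then have "(h z + h (- z)) * riesz_kernel s z \<le> (2 * B) * riesz_kernel s z"
          by (intro mult_right_mono) simp_all
        then show ?thesis unfolding eq using False by (simp add: N_def F_def)
      qed
    next
      case False
      then show ?thesis using a B by (simp add: G_def N_def F_def)
    qed
    have "2 * (LINT z|lborel. G z) = (LINT z|lborel. G z) + (LINT z|lborel. G (- z))"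
      by (simp add: lborel_integral_uminus)
    also have "\<dots> = (LINT z|lborel. G z + G (- z))"
      using G lborel_integrable_uminus[OF G] by simp
    also have "\<dots> \<le> (LINT z|lborel. 2 * a * N z + 2 * B * F z)"
      using G lborel_integrable_uminus[OF G] N F by (intro integral_mono pt) simp_all
    also have "\<dots> = 2 * a * (LINT z|lborel. N z) + 2 * B * (LINT z|lborel. F z)"
      using N F by simp
    also have "\<dots> \<le> 2 * a * (C * d powr (2 - 2 * s)) + 2 * B * (C * d powr (- 2 * s))"
      using N F a B by (intro add_mono mult_left_mono) auto
    finally show "kernel_integral s e h \<le> C * (a * d powr (2 - 2 * s) + B * d powr (- 2 * s))"
      by (simp add: kernel_integral_def G_def algebra_simps)
  qed
qed

text \<open>Here \<open>W\<close> stands for \<open>z \<mapsto> w(x + z)\<close> with \<open>w = u \<circ> R - u\<close>, and \<open>d\<close> for the distance of \<open>x\<close> from the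
reflection plane. Joining \<open>z\<close> with its mirror image \<open>z'\<close>, the integrand on the half space becomes
\<open>(W 0 - W z) K(z) + (W 0 + W z) K(z') = (W 0 - W z) (K(z) - K(z')) + 2 W(0) K(z')\<close>.
The kernel is larger at \<open>z\<close> than at \<open>z'\<close>, so upper bounds for \<open>W 0 - W z\<close> can be inserted in the first
term, and the size of \<open>W\<close> where it is large does not enter the estimate. The second term is negative, and its
contribution from a ball of radius \<open>d/2\<close> centred at distance \<open>2d\<close> from the origin already has the scaling
\<open>m d\<^bsup>-2s\<^esup>\<close>.\<close>

lemma kernel_integral_antisymmetric_le:
  assumes "0 < s" "s < 1"
  obtains C c where "0 < C" "0 < c"
    and "\<And>d a \<epsilon> m e k b (W :: real^'n::finite \<Rightarrow> real).
      \<lbrakk>0 < d; 0 \<le> a; 0 \<le> \<epsilon>; 0 \<le> m; 0 < e; e \<le> d; W \<in> borel_measurable borel; bounded (range W);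
       \<And>z. W (reflect k d z) = - W z;
       \<And>z. norm z < d \<Longrightarrow> W 0 - W z \<le> a * (2 * (b \<bullet> z) + (norm z)\<^sup>2);
       \<And>z. norm z < d \<Longrightarrow> - \<epsilon> \<le> a * (2 * (b \<bullet> z) + (norm z)\<^sup>2);
       \<And>z. z $ k < d \<Longrightarrow> W 0 - W z \<le> \<epsilon>;
       2 * W 0 + \<epsilon> \<le> - m;
       \<And>z. norm z < e \<Longrightarrow> W 0 + W z \<le> 0\<rbrakk>
       \<Longrightarrow> kernel_integral s e (\<lambda>z. W 0 - W z)
            \<le> C * (a * d powr (2 - 2 * s) + \<epsilon> * d powr (- 2 * s)) - c * m * d powr (- 2 * s)"
proof -
  obtain C where C: "0 < C" and Cle: "\<And>d a B e (h :: real^'n::finite \<Rightarrow> real).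
      \<lbrakk>0 < d; 0 \<le> a; 0 \<le> B; 0 < e; h \<in> borel_measurable borel; bounded (range h);
       \<And>z. norm z < d \<Longrightarrow> h z + h (- z) \<le> 2 * a * (norm z)\<^sup>2; \<And>z. d \<le> norm z \<Longrightarrow> h z \<le> B\<rbrakk>
       \<Longrightarrow> kernel_integral s e h \<le> C * (a * d powr (2 - 2 * s) + B * d powr (- 2 * s))"
    using kernel_integral_le[OF assms] by blast
  let ?n = "CARD('n)"
  let ?p = "real ?n + 2 * s"
  define c where "c = 6 powr (- ?p) * (unit_ball_vol ?n * (1/2) ^ ?n)"
  have c: "0 < c" unfolding c_def by (intro mult_pos_pos) auto
  show ?thesis
  proof (rule that[OF C c])
    fix d a \<epsilon> m e :: real and k :: 'n and b :: "real^'n" and W :: "real^'n \<Rightarrow> real"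
    assume d: "0 < d" and a: "0 \<le> a" and \<epsilon>: "0 \<le> \<epsilon>" and m: "0 \<le> m" and e: "0 < e" "e \<le> d"
      and [measurable]: "W \<in> borel_measurable borel" and bdd: "bounded (range W)"
      and anti: "\<And>z. W (reflect k d z) = - W z"
      and near: "\<And>z. norm z < d \<Longrightarrow> W 0 - W z \<le> a * (2 * (b \<bullet> z) + (norm z)\<^sup>2)"
      and lower: "\<And>z. norm z < d \<Longrightarrow> - \<epsilon> \<le> a * (2 * (b \<bullet> z) + (norm z)\<^sup>2)"
      and far: "\<And>z. z $ k < d \<Longrightarrow> W 0 - W z \<le> \<epsilon>"
      and min: "2 * W 0 + \<epsilon> \<le> - m"
      and small: "\<And>z. norm z < e \<Longrightarrow> W 0 + W z \<le> 0"
    define q where "q z = a * (2 * (b \<bullet> z) + (norm z)\<^sup>2)" for z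
    define K where "K = (riesz_kernel s :: real^'n \<Rightarrow> real)"
    have K0: "0 \<le> K z" for z by (simp add: K_def)
    have [measurable]: "K \<in> borel_measurable borel" unfolding K_def by measurable
    have [measurable]: "q \<in> borel_measurable borel" unfolding q_def[abs_def] by measurable
    have [measurable]: "(\<lambda>z::real^'n. z $ k) \<in> borel_measurable borel"
      by (intro borel_measurable_continuous_onI continuous_intros)
    \<comment> \<open>The upper bound that replaces \<open>W 0 - W z\<close>: the paraboloid near the origin, the constant further
      out, and 0 beyond the plane, whose mass has been folded back.\<close>
    define h where "h z = (if z $ k < d then if norm z < d then q z else \<epsilon> else 0)" for z
    have [measurable]: "h \<in> borel_measurable borel" unfolding h_def[abs_def] by measurable
    \<comment> \<open>Inside this ball the mirror images stay within distance \<open>6 d\<close> of the origin; the ball lies in the half space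
      and is disjoint from \<open>ball 0 d\<close>, so this gain is not mixed with the paraboloid bound.\<close>
    define A where "A = ball ((- 2 * d) *\<^sub>R axis k 1 :: real^'n) (d / 2)"
    have [measurable]: "A \<in> sets borel" unfolding A_def by simp
    have A: "z $ k < - (3/2) * d" "- (5/2) * d < z $ k" "3/2 * d \<le> norm z" "norm (reflect k d z) \<le> 6 * d" if "z \<in> A" for z
    proof -
      let ?v = "z - (- 2 * d) *\<^sub>R axis k 1"
      have v: "norm ?v < d / 2" using that by (simp add: A_def dist_norm norm_minus_commute)
      have "\<bar>?v $ k\<bar> \<le> norm ?v" by (rule component_le_norm_cart)
      then have zk: "\<bar>z $ k + 2 * d\<bar> < d / 2" using v by (simp add: axis_def)
      then show 1: "z $ k < - (3/2) * d" and 2: "- (5/2) * d < z $ k" by linarith+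
      have "\<bar>z $ k\<bar> \<le> norm z" by (rule component_le_norm_cart)
      then show "3/2 * d \<le> norm z" using 1 by linarith
      have "reflect k d z = ?v + (- 2 * z $ k) *\<^sub>R axis k 1" by (simp add: reflect_def algebra_simps)
      then have "norm (reflect k d z) \<le> norm ?v + norm ((- 2 * z $ k) *\<^sub>R axis k (1::real))"
        using norm_triangle_ineq by metis
      also have "norm ((- 2 * z $ k) *\<^sub>R axis k (1::real)) = 2 * \<bar>z $ k\<bar>" by simp
      finally show "norm (reflect k d z) \<le> 6 * d" using v 1 2 d by linarith
    qed
    define G where "G z = indicator {z. e \<le> norm z} z * ((W 0 - W z) * K z)" for z
    have [measurable]: "G \<in> borel_measurable borel" unfolding G_def[abs_def] by measurable
    have "bounded (range (\<lambda>z. W 0 - W z))"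
      using bounded_minus_comp[of "\<lambda>_. W 0" UNIV W] bdd by simp
    then have G: "integrable lborel G"
      unfolding G_def[abs_def] K_def
      by (rule integrable_truncated_kernel[OF assms(1) e(1), rotated]) measurable
    have hb: "\<bar>h z\<bar> \<le> a * (2 * norm b * d + d\<^sup>2) + \<epsilon>" for z
    proof (cases "norm z < d")
      case True
      have "\<bar>b \<bullet> z\<bar> \<le> norm b * norm z" by (rule Cauchy_Schwarz_ineq2)
      also have "\<dots> \<le> norm b * d" using True by (intro mult_left_mono) auto
      finally have bz: "\<bar>b \<bullet> z\<bar> \<le> norm b * d" .
      have "(norm z)\<^sup>2 \<le> d\<^sup>2" using True by (intro power_mono) auto
      then have "\<bar>2 * (b \<bullet> z) + (norm z)\<^sup>2\<bar> \<le> 2 * norm b * d + d\<^sup>2" using bz zero_le_power2[of "norm z"] by linarith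
      then have "\<bar>q z\<bar> \<le> a * (2 * norm b * d + d\<^sup>2)"
        unfolding q_def abs_mult using a by (intro mult_mono) auto
      then show ?thesis using \<epsilon> by (auto simp: h_def)
    next
      case False
      have "0 \<le> a * (2 * norm b * d + d\<^sup>2)" using a d by simp
      then show ?thesis using False \<epsilon> by (simp add: h_def)
    qed
    then have hbdd: "bounded (range h)" by (auto simp: bounded_iff)
    define H where "H z = indicator {z. e \<le> norm z} z * (h z * K z)" for z
    have [measurable]: "H \<in> borel_measurable borel" unfolding H_def[abs_def] by measurable
    have H: "integrable lborel H"
      unfolding H_def[abs_def] K_def using integrable_truncated_kernel[OF assms(1) e(1) _ hbdd] by simp
    let ?P = "{z::real^'n. z $ k < d}"
    let ?Q = "{z::real^'n. z $ k \<le> d}"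
    have P: "?P \<in> sets borel" "?Q \<in> sets borel" by measurable
    have K_reflect_le: "K (reflect k d z) \<le> K z" if "z $ k \<le> d" "z \<noteq> 0" for z
    proof -
      have "(norm z)\<^sup>2 \<le> (norm (reflect k d z))\<^sup>2" using that d by (simp add: norm_reflect_power2)
      then have "norm z \<le> norm (reflect k d z)" by (rule power2_le_imp_le) simp
      then show ?thesis using that assms by (simp add: K_def riesz_kernel_def powr_mono2')
    qed
    have pt: "indicator ?P z * G z + indicator ?Q z * G (reflect k d z) \<le> H z - m * (6 * d) powr (- ?p) * indicator A z" for z
    proof -
      consider "d < z $ k" | "z $ k = d" | "z $ k < d" by linarith
      then show ?thesis
      proof cases
        case 1
        then have "z \<notin> A" using A(1)[of z] d by auto
        then show ?thesis using 1 by (simp add: H_def h_def)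
      next
        case 2
        then have "z \<notin> A" using A(1)[of z] d by auto
        moreover have "reflect k d z = z" using 2 by (simp add: reflect_def)
        moreover have "W z = 0" using anti[of z] calculation by simp
        moreover have "W 0 * K z \<le> 0" using min \<epsilon> m K0[of z] by (intro mult_nonpos_nonneg) auto
        ultimately show ?thesis using 2 by (simp add: H_def h_def G_def indicator_def)
      next
        case 3
        let ?z = "reflect k d z"
        have "d < ?z $ k" using 3 by (simp add: reflect_nth)
        then have "e \<le> norm ?z" using component_le_norm_cart[of ?z k] e by linarith
        then have L: "indicator ?P z * G z + indicator ?Q z * G ?z = G z + (W 0 + W z) * K ?z"
          using 3 by (simp add: G_def anti)
        consider "norm z < e" | "e \<le> norm z" "norm z < d" | "d \<le> norm z" by linarith
        then show ?thesis
        proof cases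
          case 1
          then have "z \<notin> A" using A(3)[of z] e d by auto
          moreover have "(W 0 + W z) * K ?z \<le> 0" using small[OF 1] K0 by (intro mult_nonpos_nonneg) auto
          ultimately show ?thesis unfolding L using 1 by (simp add: G_def H_def)
        next
          case two: 2
          have zA: "z \<notin> A" using two A(3)[of z] d by auto
          have nz: "z \<noteq> 0" using two e by auto
          have "(W 0 - W z) * (K z - K ?z) \<le> q z * (K z - K ?z)"
            using near[OF two(2)] K_reflect_le[of z] 3 nz by (intro mult_right_mono) (auto simp: q_def)
          moreover have "(2 * W 0 - q z) * K ?z \<le> 0"
            using min lower[OF two(2)] m K0 by (intro mult_nonpos_nonneg) (auto simp: q_def)
          \<comment> \<open>The paraboloid may be negative, but only down to \<open>-\<epsilon>\<close>, which \<open>2 W(0)\<close> absorbs.\<close>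
          ultimately have "(W 0 - W z) * K z + (W 0 + W z) * K ?z \<le> q z * K z" by (simp add: algebra_simps)
          then show ?thesis unfolding L using two 3 zA by (simp add: G_def H_def h_def)
        next
          case three: 3
          have zk: "z $ k < d" by fact
          have nz: "z \<noteq> 0" using three d by auto
          have "(W 0 - W z) * (K z - K ?z) \<le> \<epsilon> * (K z - K ?z)"
            using far[OF zk] K_reflect_le[of z] zk nz by (intro mult_right_mono) auto
          moreover have "(2 * W 0 - \<epsilon>) * K ?z \<le> - m * K ?z"
            using min \<epsilon> K0 by (intro mult_right_mono) auto
          ultimately have "(W 0 - W z) * K z + (W 0 + W z) * K ?z \<le> \<epsilon> * K z - m * K ?z" by (simp add: algebra_simps)
          moreover have "(6 * d) powr (- ?p) * indicator A z \<le> K ?z"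
          proof (cases "z \<in> A")
            case True
            have "(6 * d) powr (- ?p) \<le> K ?z" unfolding K_def riesz_kernel_def
              using A(4)[OF True] \<open>d < ?z $ k\<close> d assms component_le_norm_cart[of ?z k] by (intro powr_mono2') auto
            then show ?thesis using True by simp
          qed (simp add: K0)
          then have "m * ((6 * d) powr (- ?p) * indicator A z) \<le> m * K ?z" by (intro mult_left_mono m)
          ultimately show ?thesis unfolding L using three zk e by (simp add: G_def H_def h_def)
        qed
      qed
    qed
    have split: "(LINT z|lborel. G z) = (LINT z|lborel. indicator ?P z * G z + indicator ?Q z * G (reflect k d z))"
    proof -
      have i1: "integrable lborel (\<lambda>z. indicator ?P z * G z)"
        using integrable_mult_indicator[OF _ G, of ?P] P by simp
      have i2: "integrable lborel (\<lambda>z. indicator (- ?P) z * G z)"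
        using integrable_mult_indicator[OF _ G, of "- ?P"] P by simp
      have i3: "integrable lborel (\<lambda>z. indicator ?Q z * G (reflect k d z))"
        using integrable_mult_indicator[OF _ lborel_integrable_reflect[OF G], of ?Q] P by simp
      have "(LINT z|lborel. G z) = (LINT z|lborel. indicator ?P z * G z + indicator (- ?P) z * G z)"
        by (intro Bochner_Integration.integral_cong refl) (auto simp: indicator_def)
      also have "\<dots> = (LINT z|lborel. indicator ?P z * G z) + (LINT z|lborel. indicator (- ?P) z * G z)"
        using i1 i2 by simp
      also have "(LINT z|lborel. indicator (- ?P) z * G z) = (LINT z|lborel. (\<lambda>z. indicator (- ?P) z * G z) (reflect k d z))"
        by (rule lborel_integral_reflect[symmetric]) (use P in measurable)
      also have "\<dots> = (LINT z|lborel. indicator ?Q z * G (reflect k d z))"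
        by (intro Bochner_Integration.integral_cong refl) (auto simp: indicator_def reflect_nth)
      finally show ?thesis using i1 i3 by simp
    qed
    have Aint: "integrable lborel (\<lambda>z. m * (6 * d) powr (- ?p) * indicator A z)"
      using d by (intro integrable_mult_right integrable_real_indicator) (auto simp: A_def emeasure_ball)
    have "kernel_integral s e (\<lambda>z. W 0 - W z) = (LINT z|lborel. G z)"
      by (simp add: kernel_integral_def G_def[abs_def] K_def)
    also have "\<dots> \<le> (LINT z|lborel. H z - m * (6 * d) powr (- ?p) * indicator A z)"
      unfolding split
    proof (rule integral_mono[OF _ _ pt])
      show "integrable lborel (\<lambda>z. indicator ?P z * G z + indicator ?Q z * G (reflect k d z))"
        using integrable_mult_indicator[OF _ G, of ?P]
          integrable_mult_indicator[OF _ lborel_integrable_reflect[OF G], of ?Q] P by simp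
      show "integrable lborel (\<lambda>z. H z - m * (6 * d) powr (- ?p) * indicator A z)"
        using H Aint by (rule Bochner_Integration.integrable_diff)
    qed
    also have "\<dots> = kernel_integral s e h - m * (6 * d) powr (- ?p) * measure lborel A"
      using Bochner_Integration.integral_diff[OF H Aint]
      by (simp add: kernel_integral_def H_def[abs_def] K_def)
    also have "kernel_integral s e h \<le> C * (a * d powr (2 - 2 * s) + \<epsilon> * d powr (- 2 * s))"
    proof (rule Cle[OF d a \<epsilon> e(1) _ hbdd])
      show "h z + h (- z) \<le> 2 * a * (norm z)\<^sup>2" if "norm z < d" for z
      proof -
        have "\<bar>z $ k\<bar> < d" using component_le_norm_cart[of z k] that by linarith
        then have "z $ k < d" "(- z) $ k < d" by auto
        then have "h z = q z" "h (- z) = q (- z)" using that by (simp_all add: h_def)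
        then show ?thesis by (simp add: q_def algebra_simps)
      qed
      show "h z \<le> \<epsilon>" if "d \<le> norm z" for z using that \<epsilon> by (simp add: h_def)
    qed simp
    also have "m * (6 * d) powr (- ?p) * measure lborel A = c * m * d powr (- 2 * s)"
    proof -
      have "measure lborel A = unit_ball_vol ?n * (d / 2) ^ ?n" using d by (simp add: A_def content_ball)
      also have "\<dots> = unit_ball_vol ?n * (1/2) ^ ?n * d powr ?n"
        using d by (simp add: powr_realpow power_divide)
      finally have "m * (6 * d) powr (- ?p) * measure lborel A = c * m * (d powr (- ?p) * d powr ?n)"
        using d by (simp add: powr_mult c_def)
      then show ?thesis by (simp add: powr_add[symmetric])
    qed
    finally show "kernel_integral s e (\<lambda>z. W 0 - W z)
            \<le> C * (a * d powr (2 - 2 * s) + \<epsilon> * d powr (- 2 * s)) - c * m * d powr (- 2 * s)" by simp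
  qed
qed

section \<open>Second differences and the Laplacian\<close>

text \<open>Symmetric second differences are convenient for two reasons: the first order terms of a touching
paraboloid drop out, and a reflection maps a symmetric pair of points to a symmetric pair, so that
the partial derivatives of a reflected function need not be computed.\<close>

lemma second_difference_tendsto:
  fixes u :: "real^'n::finite \<Rightarrow> real"
  assumes "u \<in> C2_functions"
  shows "((\<lambda>t. (u (x + t *\<^sub>R axis i 1) + u (x - t *\<^sub>R axis i 1) - 2 * u x) / t\<^sup>2)
    \<longlongrightarrow> partial_deriv i (partial_deriv i u) x) (at_right 0)"
proof -
  have shift: "((\<lambda>t. v (x + t *\<^sub>R axis i 1)) has_real_derivative partial_deriv i v (x + t *\<^sub>R axis i 1)) (at t)"
    if "partially_differentiable_at i v (x + t *\<^sub>R axis i 1)" for t and v :: "real^'n \<Rightarrow> real"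
  proof -
    have "((\<lambda>\<tau>. v (x + t *\<^sub>R axis i 1 + \<tau> *\<^sub>R axis i 1)) has_real_derivative partial_deriv i v (x + t *\<^sub>R axis i 1)) (at 0)"
      using that unfolding partially_differentiable_at_def partial_deriv_def by (rule field_differentiable_derivI)
    then have "((\<lambda>\<tau>. v (x + (\<tau> + t) *\<^sub>R axis i 1)) has_real_derivative partial_deriv i v (x + t *\<^sub>R axis i 1)) (at 0)"
      by (simp add: scaleR_add_left add_ac)
    then show ?thesis
      using DERIV_shift[of "\<lambda>t. v (x + t *\<^sub>R axis i 1)" _ 0 t] by simp
  qed
  define \<phi> where "\<phi> t = u (x + t *\<^sub>R axis i 1)" for t
  define \<phi>' where "\<phi>' t = partial_deriv i u (x + t *\<^sub>R axis i 1)" for t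
  define D where "D = partial_deriv i (partial_deriv i u) x"
  have pd: "partially_differentiable_at i u y" "partially_differentiable_at i (partial_deriv i u) y" for y
    using assms by (auto simp: C2_functions_def)
  have d1: "(\<phi> has_real_derivative \<phi>' t) (at t)" for t
    unfolding \<phi>_def[abs_def] \<phi>'_def by (rule shift) (rule pd)
  have d2: "(\<phi>' has_real_derivative D) (at 0)"
    using shift[of "partial_deriv i u" 0] pd unfolding \<phi>'_def[abs_def] D_def by simp
  have slope: "((\<lambda>t. (\<phi>' t - \<phi>' 0) / t) \<longlongrightarrow> D) (at 0)"
    using d2 by (simp add: has_field_derivative_iff)
  have s1: "((\<lambda>t. (\<phi>' t - \<phi>' 0) / t) \<longlongrightarrow> D) (at_right 0)"
    using slope by (rule filterlim_mono) (auto simp: at_within_le_at)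
  have s2: "((\<lambda>t. (\<phi>' (- t) - \<phi>' 0) / (- t)) \<longlongrightarrow> D) (at_right 0)"
  proof -
    have "((\<lambda>t. (\<phi>' t - \<phi>' 0) / t) \<longlongrightarrow> D) (at_left 0)"
      using slope by (rule filterlim_mono) (auto simp: at_within_le_at)
    then show ?thesis by (simp add: filterlim_at_left_to_right)
  qed
  have cont: "continuous (at t) \<phi>" for t using d1 by (rule DERIV_isCont)
  have "((\<lambda>t. (\<phi> t + \<phi> (- t) - 2 * \<phi> 0) / t\<^sup>2) \<longlongrightarrow> D) (at_right 0)"
  proof (rule lhopital_right_0)
    have "((\<lambda>t. \<phi> t + \<phi> (- t) - 2 * \<phi> 0) \<longlongrightarrow> \<phi> 0 + \<phi> (- 0) - 2 * \<phi> 0) (at_right 0)"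
    proof (intro tendsto_intros)
      show "(\<phi> \<longlongrightarrow> \<phi> 0) (at_right 0)"
        using cont[of 0] by (auto simp: isCont_def intro: filterlim_mono at_within_le_at)
      have "isCont (\<lambda>t. \<phi> (- t)) 0"
        by (rule isCont_o2[where g = \<phi>]) (use cont in auto)
      then show "((\<lambda>t. \<phi> (- t)) \<longlongrightarrow> \<phi> (- 0)) (at_right 0)"
        by (auto simp: isCont_def intro: filterlim_mono at_within_le_at)
    qed
    then show "((\<lambda>t. \<phi> t + \<phi> (- t) - 2 * \<phi> 0) \<longlongrightarrow> 0) (at_right 0)" by simp
    show "((\<lambda>t::real. t\<^sup>2) \<longlongrightarrow> 0) (at_right 0)"
      by (rule tendsto_eq_intros refl | simp)+
    show "\<forall>\<^sub>F t::real in at_right 0. t\<^sup>2 \<noteq> 0"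
      using eventually_at_right_less[of "0::real"] by eventually_elim simp
    show "\<forall>\<^sub>F t::real in at_right 0. 2 * t \<noteq> 0"
      using eventually_at_right_less[of "0::real"] by eventually_elim simp
    show "\<forall>\<^sub>F t in at_right 0. ((\<lambda>t. \<phi> t + \<phi> (- t) - 2 * \<phi> 0) has_real_derivative \<phi>' t - \<phi>' (- t)) (at t)"
      by (intro always_eventually allI) (auto intro!: derivative_eq_intros d1 DERIV_chain2[of \<phi>])
    show "\<forall>\<^sub>F t in at_right 0. ((\<lambda>t::real. t\<^sup>2) has_real_derivative 2 * t) (at t)"
      by (intro always_eventually allI) (auto intro!: derivative_eq_intros)
    have "((\<lambda>t. ((\<phi>' t - \<phi>' 0) / t + (\<phi>' (- t) - \<phi>' 0) / (- t)) / 2) \<longlongrightarrow> (D + D) / 2) (at_right 0)"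
      by (intro tendsto_intros s1 s2) simp
    then have "((\<lambda>t. ((\<phi>' t - \<phi>' 0) / t + (\<phi>' (- t) - \<phi>' 0) / (- t)) / 2) \<longlongrightarrow> D) (at_right 0)" by simp
    moreover have "\<forall>\<^sub>F t in at_right 0. ((\<phi>' t - \<phi>' 0) / t + (\<phi>' (- t) - \<phi>' 0) / (- t)) / 2 = (\<phi>' t - \<phi>' (- t)) / (2 * t)"
      using eventually_at_right_less[of "0::real"] by eventually_elim (simp add: field_simps)
    ultimately show "((\<lambda>t. (\<phi>' t - \<phi>' (- t)) / (2 * t)) \<longlongrightarrow> D) (at_right 0)"
      by (rule Lim_transform_eventually)
  qed
  then show ?thesis by (simp add: \<phi>_def D_def)
qed

lemma laplacian_ge:
  fixes u :: "real^'n::finite \<Rightarrow> real"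
  assumes u: "u \<in> C2_functions" and \<delta>: "0 < \<delta>"
    and ge: "\<And>z. norm z < \<delta> \<Longrightarrow> - 2 * a * (norm z)\<^sup>2 \<le> u (x + z) + u (x - z) - 2 * u x"
  shows "- 2 * a * CARD('n) \<le> laplacian u x"
proof -
  have "- 2 * a \<le> partial_deriv i (partial_deriv i u) x" for i
  proof (rule tendsto_lowerbound[OF second_difference_tendsto[OF u]])
    show "\<forall>\<^sub>F t in at_right 0. - 2 * a \<le> (u (x + t *\<^sub>R axis i 1) + u (x - t *\<^sub>R axis i 1) - 2 * u x) / t\<^sup>2"
      using eventually_at_right_less[of "0::real"] eventually_at_rightI[of 0 \<delta> "\<lambda>t. t < \<delta>", OF _ \<delta>, simplified]
    proof eventually_elim
      case (elim t)
      then have "- 2 * a * t\<^sup>2 \<le> u (x + t *\<^sub>R axis i 1) + u (x - t *\<^sub>R axis i 1) - 2 * u x"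
        using ge[of "t *\<^sub>R axis i 1"] by simp
      then show ?case using elim by (simp add: field_simps)
    qed
  qed simp
  then have "(\<Sum>i\<in>(UNIV::'n set). - 2 * a) \<le> laplacian u x" unfolding laplacian_def by (rule sum_mono)
  then show ?thesis by (simp add: mult_ac)
qed

lemma laplacian_reflect_diff_ge:
  fixes u :: "real^'n::finite \<Rightarrow> real"
  assumes u: "u \<in> C2_functions" and \<delta>: "0 < \<delta>"
    and ge: "\<And>z. norm z < \<delta> \<Longrightarrow> - 2 * a * (norm z)\<^sup>2 \<le>
      (u (reflect k c (x + z)) - u (x + z)) + (u (reflect k c (x - z)) - u (x - z)) - 2 * (u (reflect k c x) - u x)"
  shows "- 2 * a * CARD('n) \<le> laplacian u (reflect k c x) - laplacian u x"
proof -
  let ?R = "reflect k c"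
  have "- 2 * a \<le> partial_deriv i (partial_deriv i u) (?R x) - partial_deriv i (partial_deriv i u) x" for i
  proof (rule tendsto_lowerbound[OF tendsto_diff[OF second_difference_tendsto[OF u] second_difference_tendsto[OF u]]])
    show "\<forall>\<^sub>F t in at_right 0. - 2 * a \<le>
        (u (?R x + t *\<^sub>R axis i 1) + u (?R x - t *\<^sub>R axis i 1) - 2 * u (?R x)) / t\<^sup>2
        - (u (x + t *\<^sub>R axis i 1) + u (x - t *\<^sub>R axis i 1) - 2 * u x) / t\<^sup>2"
      using eventually_at_right_less[of "0::real"] eventually_at_rightI[of 0 \<delta> "\<lambda>t. t < \<delta>", OF _ \<delta>, simplified]
    proof eventually_elim
      case (elim t)
      have sym: "u (?R (x + t *\<^sub>R axis i 1)) + u (?R (x - t *\<^sub>R axis i 1)) =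
          u (?R x + t *\<^sub>R axis i 1) + u (?R x - t *\<^sub>R axis i 1)"
      proof (cases "i = k")
        case True
        then have "?R (x + t *\<^sub>R axis i 1) = ?R x - t *\<^sub>R axis i 1" "?R (x - t *\<^sub>R axis i 1) = ?R x + t *\<^sub>R axis i 1"
          by (simp_all add: vec_eq_iff reflect_nth axis_def)
        then show ?thesis by simp
      next
        case False
        then have "?R (x + t *\<^sub>R axis i 1) = ?R x + t *\<^sub>R axis i 1" "?R (x - t *\<^sub>R axis i 1) = ?R x - t *\<^sub>R axis i 1"
          by (simp_all add: vec_eq_iff reflect_nth axis_def)
        then show ?thesis by simp
      qed
      have "- 2 * a * t\<^sup>2 \<le> (u (?R x + t *\<^sub>R axis i 1) + u (?R x - t *\<^sub>R axis i 1) - 2 * u (?R x))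
          - (u (x + t *\<^sub>R axis i 1) + u (x - t *\<^sub>R axis i 1) - 2 * u x)"
        using ge[of "t *\<^sub>R axis i 1"] elim sym by simp
      then show ?case using elim by (simp add: diff_divide_distrib[symmetric] pos_le_divide_eq)
    qed
  qed simp
  then have "(\<Sum>i\<in>(UNIV::'n set). - 2 * a) \<le>
      (\<Sum>i\<in>UNIV. partial_deriv i (partial_deriv i u) (?R x) - partial_deriv i (partial_deriv i u) x)"
    by (rule sum_mono)
  then show ?thesis by (simp add: laplacian_def sum_subtractf mult_ac)
qed

lemma frac_const_pos:
  assumes "0 < s" "s < 1"
  shows "0 < frac_const n s"
  unfolding frac_const_def using assms by (intro divide_pos_pos mult_pos_pos Gamma_real_pos) auto

section \<open>The operator near minima\<close>

definition mixed_operator :: "real \<Rightarrow> (real^'n::finite \<Rightarrow> real) \<Rightarrow> real^'n \<Rightarrow> real" where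
  "mixed_operator s u x = frac_laplacian s u x - laplacian u x"

lemma frac_laplacian_eq:
  assumes "(frac_truncated_integral s u x \<longlongrightarrow> l) (at_right 0)"
  shows "frac_laplacian s (u :: real^'n::finite \<Rightarrow> real) x = frac_const CARD('n) s * l"
  unfolding frac_laplacian_def using tendsto_Lim[OF _ assms] by simp

text \<open>The substitute for evaluating the operator at a minimum that need not be attained. It is essential
that \<open>c\<close> depends on the dimension and on \<open>s\<close> only, and that the bound scales with the distance to the
plane: the planes come from infinity and the points may approach the plane or leave every bounded
set.\<close>

lemma mixed_operator_reflection_near_minimum:
  assumes s: "0 < s" "s < 1"
  obtains c where "0 < c"
    and "\<And>k \<mu> m (u :: real^'n::finite \<Rightarrow> real).
      \<lbrakk>u \<in> C2_functions; bounded (range u); \<And>x. \<exists>l. (frac_truncated_integral s u x \<longlongrightarrow> l) (at_right 0);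
       0 < m; \<And>x. x $ k < \<mu> \<Longrightarrow> - m \<le> u (reflect k \<mu> x) - u x;
       \<And>\<eta>. 0 < \<eta> \<Longrightarrow> \<exists>x. x $ k < \<mu> \<and> u (reflect k \<mu> x) - u x < - m + \<eta>\<rbrakk>
      \<Longrightarrow> \<exists>x. x $ k < \<mu> \<and> u (reflect k \<mu> x) < u x \<and>
        mixed_operator s u (reflect k \<mu> x) - mixed_operator s u x \<le> - c * m * (\<mu> - x $ k) powr (- 2 * s)"
proof -
  obtain C c0 where C: "0 < C" and c0: "0 < c0"
    and anti: "\<And>d a \<epsilon> m e k b (W :: real^'n::finite \<Rightarrow> real).
      \<lbrakk>0 < d; 0 \<le> a; 0 \<le> \<epsilon>; 0 \<le> m; 0 < e; e \<le> d; W \<in> borel_measurable borel; bounded (range W);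
       \<And>z. W (reflect k d z) = - W z;
       \<And>z. norm z < d \<Longrightarrow> W 0 - W z \<le> a * (2 * (b \<bullet> z) + (norm z)\<^sup>2);
       \<And>z. norm z < d \<Longrightarrow> - \<epsilon> \<le> a * (2 * (b \<bullet> z) + (norm z)\<^sup>2);
       \<And>z. z $ k < d \<Longrightarrow> W 0 - W z \<le> \<epsilon>;
       2 * W 0 + \<epsilon> \<le> - m;
       \<And>z. norm z < e \<Longrightarrow> W 0 + W z \<le> 0\<rbrakk>
       \<Longrightarrow> kernel_integral s e (\<lambda>z. W 0 - W z)
            \<le> C * (a * d powr (2 - 2 * s) + \<epsilon> * d powr (- 2 * s)) - c0 * m * d powr (- 2 * s)"
    using kernel_integral_antisymmetric_le[OF s, where 'n='n] by blast
  define n where "n = real CARD('n)"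
  define \<Lambda> where "\<Lambda> = frac_const CARD('n) s"
  have \<Lambda>: "0 < \<Lambda>" unfolding \<Lambda>_def by (rule frac_const_pos[OF s])
  have n: "0 < n" by (simp add: n_def)
  define M where "M = 5 * C * \<Lambda> + 8 * n"
  have M: "0 < M" using C \<Lambda> n by (simp add: M_def add_pos_pos)
  \<comment> \<open>The relative size of the perturbation: the error terms add up to \<open>M * \<eta> * m * d powr (- 2 * s)\<close>
    and may consume half of the gain \<open>\<Lambda> * c0 * m * d powr (- 2 * s)\<close>.\<close>
  define \<eta> where "\<eta> = min (1/2) (\<Lambda> * c0 / (2 * M))"
  have \<eta>: "0 < \<eta>" "\<eta> \<le> 1/2" using \<Lambda> c0 M by (auto simp: \<eta>_def)
  have M\<eta>: "M * \<eta> \<le> \<Lambda> * c0 / 2"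
  proof -
    have "M * \<eta> \<le> M * (\<Lambda> * c0 / (2 * M))" using M by (intro mult_left_mono) (auto simp: \<eta>_def)
    then show ?thesis using M by simp
  qed
  show ?thesis
  proof (rule that)
    show "0 < \<Lambda> * c0 / 2" using \<Lambda> c0 by simp
  next
    fix k :: 'n and \<mu> m :: real and u :: "real^'n \<Rightarrow> real"
    assume u: "u \<in> C2_functions" and bdd: "bounded (range u)"
      and lim: "\<And>x. \<exists>l. (frac_truncated_integral s u x \<longlongrightarrow> l) (at_right 0)"
      and m: "0 < m" and ge: "\<And>x. x $ k < \<mu> \<Longrightarrow> - m \<le> u (reflect k \<mu> x) - u x"
      and inf: "\<And>\<eta>. 0 < \<eta> \<Longrightarrow> \<exists>x. x $ k < \<mu> \<and> u (reflect k \<mu> x) - u x < - m + \<eta>"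
    define R where "R = reflect k \<mu>"
    define w where "w x = u (R x) - u x" for x
    have ucont: "continuous_on UNIV u" using u by (simp add: C2_functions_def)
    have wcont: "continuous_on S w" for S
    proof -
      have "continuous_on S (\<lambda>x. u (R x))" unfolding R_def
        by (rule continuous_on_compose2[OF ucont continuous_on_reflect]) simp
      moreover have "continuous_on S u" using ucont by (rule continuous_on_subset) simp
      ultimately show ?thesis unfolding w_def[abs_def] by (intro continuous_intros)
    qed
    define \<epsilon> where "\<epsilon> = \<eta> * m"
    have \<epsilon>: "0 < \<epsilon>" "2 * \<epsilon> \<le> m" using \<eta> m by (auto simp: \<epsilon>_def)
    obtain p where p: "p $ k < \<mu>" "w p < - m + \<epsilon> / 2"
      using inf[of "\<epsilon> / 2"] \<epsilon> by (auto simp: w_def R_def)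
    \<comment> \<open>The radius must be at least 1 for the Laplacian of the paraboloid and at least of the order of the
      distance to the plane for its fractional Laplacian; with this choice both are \<open>O(\<epsilon> d\<^bsup>-2s\<^esup>)\<close>.\<close>
    define r where "r = max 1 (\<mu> - p $ k)"
    have r: "1 \<le> r" "\<mu> - p $ k \<le> r" by (auto simp: r_def)
    define a where "a = \<epsilon> / r\<^sup>2"
    have a: "0 < a" using \<epsilon> r by (simp add: a_def)
    have ar: "a * r\<^sup>2 = \<epsilon>" using r by (simp add: a_def)
    define \<Psi> where "\<Psi> x = w x + a * (norm (x - p))\<^sup>2" for x
    define S where "S = cball p r \<inter> {x. x $ k \<le> \<mu>}"
    have "closed {x::real^'n. x $ k \<le> \<mu>}" by (intro closed_Collect_le continuous_intros)
    then have "compact S" unfolding S_def by (intro compact_Int_closed compact_cball)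
    moreover have pS: "p \<in> S" using p r by (simp add: S_def)
    moreover have "continuous_on S \<Psi>" unfolding \<Psi>_def[abs_def] by (intro continuous_intros wcont)
    ultimately obtain x where x: "x \<in> S" and xmin: "\<And>y. y \<in> S \<Longrightarrow> \<Psi> x \<le> \<Psi> y"
      using continuous_attains_inf[of S \<Psi>] by blast
    have \<Psi>x: "\<Psi> x < - m + \<epsilon> / 2" using xmin[OF pS] p by (simp add: \<Psi>_def)
    have wx: "w x < - m + \<epsilon> / 2" using \<Psi>x a by (simp add: \<Psi>_def) (smt (verit) mult_nonneg_nonneg zero_le_power2)
    have xk: "x $ k < \<mu>"
    proof (rule ccontr)
      assume "\<not> x $ k < \<mu>"
      then have "x $ k = \<mu>" using x by (simp add: S_def)
      then have "w x = 0" by (simp add: w_def R_def reflect_def)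
      then show False using wx \<epsilon> by simp
    qed
    have wge: "- m \<le> w y" if "y $ k < \<mu>" for y using ge[OF that] by (simp add: w_def R_def)
    have xp: "a * (norm (x - p))\<^sup>2 < \<epsilon> / 2" using \<Psi>x wge[OF xk] by (simp add: \<Psi>_def)
    have xr: "norm (x - p) \<le> r" using x by (simp add: S_def dist_norm norm_minus_commute)
    \<comment> \<open>The minimum over the ball is a minimum over the half space, since outside the ball the paraboloid
      is at least \<open>\<epsilon>\<close> while \<open>w\<close> stays above \<open>- m\<close>.\<close>
    have glob: "\<Psi> x \<le> \<Psi> y" if "y $ k < \<mu>" for y
    proof (cases "y \<in> cball p r")
      case True
      then show ?thesis using that xmin[of y] by (simp add: S_def)
    next
      case False
      then have "r\<^sup>2 \<le> (norm (y - p))\<^sup>2" using r by (intro power_mono) (auto simp: dist_norm norm_minus_commute)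
      then have "\<epsilon> \<le> a * (norm (y - p))\<^sup>2" using a ar by (metis mult_left_mono less_imp_le)
      then show ?thesis using \<Psi>x wge[OF that] \<epsilon> by (simp add: \<Psi>_def)
    qed
    define d where "d = \<mu> - x $ k"
    have d: "0 < d" using xk by (simp add: d_def)
    have d2r: "d \<le> 2 * r"
    proof -
      have "\<bar>(x - p) $ k\<bar> \<le> norm (x - p)" by (rule component_le_norm_cart)
      then show ?thesis using xr r by (simp add: d_def)
    qed
    define W where "W z = w (x + z)" for z
    define b where "b = x - p"
    have expand: "a * (norm (x + z - p))\<^sup>2 = a * (norm (x - p))\<^sup>2 + a * (2 * (b \<bullet> z) + (norm z)\<^sup>2)" for z
      by (simp add: b_def power2_norm_eq_inner inner_diff_left inner_diff_right inner_add_left inner_add_right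
          inner_commute algebra_simps)
    have inner_half: "(x + z) $ k < \<mu>" if "z $ k < d" for z using that by (simp add: d_def)
    have zk: "z $ k < d" if "norm z < d" for z
      using component_le_norm_cart[of z k] that by linarith
    have near: "W 0 - W z \<le> a * (2 * (b \<bullet> z) + (norm z)\<^sup>2)" if "norm z < d" for z
      using glob[OF inner_half[OF zk[OF that]]] expand[of z] by (simp add: \<Psi>_def W_def)
    have Wcont: "continuous_on UNIV W" unfolding W_def[abs_def]
      by (rule continuous_on_compose2[OF wcont[of UNIV]]) (auto intro!: continuous_intros)
    have Wm [measurable]: "W \<in> borel_measurable borel" using Wcont by (rule borel_measurable_continuous_onI)
    obtain B where B: "\<And>y. \<bar>u y\<bar> \<le> B" using bdd by (auto simp: bounded_iff)
    have Wb: "bounded (range W)"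
    proof -
      have "\<bar>W z\<bar> \<le> 2 * B" for z
        using B[of "R (x + z)"] B[of "x + z"] unfolding W_def w_def by linarith
      then show ?thesis by (auto simp: bounded_iff)
    qed
    have Wanti: "W (reflect k d z) = - W z" for z
    proof -
      have "x + reflect k d z = R (x + z)" by (simp add: R_def vec_eq_iff reflect_nth d_def)
      then show ?thesis by (simp add: W_def w_def R_def)
    qed
    have "\<exists>\<delta>>0. \<forall>z. norm z < \<delta> \<longrightarrow> W 0 + W z \<le> 0"
    proof -
      have "isCont W 0" using Wcont by (simp add: continuous_on_eq_continuous_at)
      moreover have "0 < - W 0" using wx \<epsilon> by (simp add: W_def)
      ultimately obtain \<delta> where \<delta>: "0 < \<delta>" "\<forall>z. dist z 0 < \<delta> \<longrightarrow> dist (W z) (W 0) < - W 0"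
        unfolding continuous_at_eps_delta by blast
      have "W 0 + W z \<le> 0" if "norm z < \<delta>" for z
      proof -
        have "\<bar>W z - W 0\<bar> < - W 0" using \<delta>(2) that by (simp add: dist_real_def)
        then show ?thesis by linarith
      qed
      then show ?thesis using \<delta>(1) by blast
    qed
    then obtain \<delta> where \<delta>: "0 < \<delta>" "\<And>z. norm z < \<delta> \<Longrightarrow> W 0 + W z \<le> 0" by blast
    define Q where "Q = C * (a * d powr (2 - 2 * s) + \<epsilon> * d powr (- 2 * s)) - c0 * m * d powr (- 2 * s)"
    have ki: "kernel_integral s e (\<lambda>z. W 0 - W z) \<le> Q" if e: "0 < e" "e < min d \<delta>" for e
      unfolding Q_def
    proof (rule anti[where b = b and k = k])
      show "- \<epsilon> \<le> a * (2 * (b \<bullet> z) + (norm z)\<^sup>2)" if "norm z < d" for z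
      proof -
        have "0 \<le> a * (norm (x + z - p))\<^sup>2" using a by simp
        then show ?thesis using expand[of z] xp \<epsilon> by linarith
      qed
      show "W 0 - W z \<le> \<epsilon>" if "z $ k < d" for z
        using wge[OF inner_half[OF that]] wx \<epsilon> by (simp add: W_def)
      show "2 * W 0 + \<epsilon> \<le> - m" using wx \<epsilon> by (simp add: W_def)
      show "W 0 + W z \<le> 0" if "norm z < e" for z using \<delta>(2)[of z] that e by simp
    qed (use d a \<epsilon> m e near Wanti Wm Wb in auto)
    obtain l1 where l1: "(frac_truncated_integral s u (R x) \<longlongrightarrow> l1) (at_right 0)" using lim by blast
    obtain l2 where l2: "(frac_truncated_integral s u x \<longlongrightarrow> l2) (at_right 0)" using lim by blast
    have trunc: "frac_truncated_integral s u (R x) e - frac_truncated_integral s u x e = kernel_integral s e (\<lambda>z. W 0 - W z)"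
      if e: "0 < e" for e
    proof -
      have [measurable]: "u \<in> borel_measurable borel" using ucont by (rule borel_measurable_continuous_onI)
      have [measurable]: "R \<in> borel_measurable borel" unfolding R_def by measurable
      define h where "h z = u (R x) - u (R (x + z))" for z
      define h' where "h' z = u x - u (x + z)" for z
      have hm: "h \<in> borel_measurable borel" unfolding h_def[abs_def] by measurable
      have hm': "h' \<in> borel_measurable borel" unfolding h'_def[abs_def] by measurable
      have "\<bar>h z\<bar> \<le> 2 * B" for z using B[of "R x"] B[of "R (x + z)"] unfolding h_def by linarith
      then have hb: "bounded (range h)" by (auto simp: bounded_iff)
      have "\<bar>h' z\<bar> \<le> 2 * B" for z using B[of x] B[of "x + z"] unfolding h'_def by linarith
      then have hb': "bounded (range h')" by (auto simp: bounded_iff)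
      have "frac_truncated_integral s u (R x) e = kernel_integral s e (\<lambda>z. u (R x) - u (R x + z))"
        by (rule frac_truncated_integral_eq_kernel_integral[OF ucont])
      also have "\<dots> = kernel_integral s e (\<lambda>z. u (R x) - u (R x + reflect k 0 z))"
        by (rule kernel_integral_reflect_0[symmetric, of "\<lambda>z. u (R x) - u (R x + z)"]) measurable
      also have "\<dots> = kernel_integral s e h" by (simp add: h_def[abs_def] R_def reflect_add)
      finally have 1: "frac_truncated_integral s u (R x) e = kernel_integral s e h" .
      have 2: "frac_truncated_integral s u x e = kernel_integral s e h'"
        unfolding h'_def[abs_def] by (rule frac_truncated_integral_eq_kernel_integral[OF ucont])
      have "(\<lambda>z. W 0 - W z) = (\<lambda>z. h z - h' z)" by (simp add: W_def w_def h_def h'_def fun_eq_iff)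
      then show ?thesis using kernel_integral_diff[OF s(1) e hm hb hm' hb'] 1 2 by simp
    qed
    have l12: "l1 - l2 \<le> Q"
    proof (rule tendsto_upperbound[OF tendsto_diff[OF l1 l2]])
      show "\<forall>\<^sub>F e in at_right 0. frac_truncated_integral s u (R x) e - frac_truncated_integral s u x e \<le> Q"
        by (rule eventually_at_rightI[of 0 "min d \<delta>"]) (use d \<delta> trunc ki in auto)
    qed simp
    have lap: "- 2 * a * n \<le> laplacian u (R x) - laplacian u x"
      unfolding R_def n_def
    proof (rule laplacian_reflect_diff_ge[OF u d])
      fix z :: "real^'n" assume z: "norm z < d"
      have "W 0 - W z + (W 0 - W (- z)) \<le> a * (2 * (b \<bullet> z) + (norm z)\<^sup>2) + a * (2 * (b \<bullet> (- z)) + (norm (- z))\<^sup>2)"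
        using near[OF z] near[of "- z"] z by (intro add_mono) auto
      also have "\<dots> = 2 * a * (norm z)\<^sup>2" by (simp add: algebra_simps)
      finally show "- 2 * a * (norm z)\<^sup>2 \<le>
          (u (reflect k \<mu> (x + z)) - u (x + z)) + (u (reflect k \<mu> (x - z)) - u (x - z)) - 2 * (u (reflect k \<mu> x) - u x)"
        by (simp add: W_def w_def R_def)
    qed
    define D where "D = d powr (- 2 * s)"
    have D: "0 < D" using d by (simp add: D_def)
    have aD: "a \<le> 4 * \<epsilon> * D"
    proof -
      have "d powr (2 * s) \<le> (2 * r) powr (2 * s)" using d d2r s by (intro powr_mono2) auto
      also have "\<dots> \<le> (2 * r) powr 2" using r s by (intro powr_mono) auto
      also have "\<dots> = 4 * r\<^sup>2" using r by (simp add: powr_realpow power_mult_distrib)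
      finally have "d powr (2 * s) \<le> 4 * r\<^sup>2" .
      then have "a * d powr (2 * s) \<le> a * (4 * r\<^sup>2)" using a by (intro mult_left_mono) auto
      then have "a * d powr (2 * s) \<le> 4 * \<epsilon>" using ar by simp
      then have "a * d powr (2 * s) * D \<le> 4 * \<epsilon> * D" using D by (intro mult_right_mono) auto
      then show ?thesis using d by (simp add: D_def powr_add[symmetric] mult.assoc)
    qed
    have adD: "a * d powr (2 - 2 * s) \<le> 4 * \<epsilon> * D"
    proof -
      have "d powr (2 - 2 * s) = d\<^sup>2 * D"
        using d powr_add[of d 2 "- 2 * s"] by (simp add: D_def powr_realpow)
      moreover have "a * d\<^sup>2 \<le> 4 * \<epsilon>"
      proof -
        have "d\<^sup>2 \<le> (2 * r)\<^sup>2" using d d2r by (intro power_mono) auto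
        then have "a * d\<^sup>2 \<le> a * (4 * r\<^sup>2)" using a by (intro mult_left_mono) (auto simp: power_mult_distrib)
        then show ?thesis using ar by simp
      qed
      ultimately show ?thesis using D mult_right_mono[of "a * d\<^sup>2" "4 * \<epsilon>" D] by (simp add: mult.assoc)
    qed
    have "Q \<le> C * (5 * \<epsilon> * D) - c0 * m * D"
      using mult_left_mono[OF adD, of C] C unfolding Q_def D_def[symmetric] by (simp add: algebra_simps)
    then have "\<Lambda> * (l1 - l2) \<le> \<Lambda> * (C * (5 * \<epsilon> * D) - c0 * m * D)"
      using l12 \<Lambda> by (intro mult_left_mono) auto
    moreover have "2 * n * a \<le> 2 * n * (4 * \<epsilon> * D)" using aD n by (intro mult_left_mono) auto
    ultimately have "\<Lambda> * (l1 - l2) - (laplacian u (R x) - laplacian u x) \<le> M * \<epsilon> * D - \<Lambda> * c0 * m * D"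
      using lap unfolding M_def by (simp add: algebra_simps)
    moreover have "M * \<epsilon> * D \<le> \<Lambda> * c0 / 2 * m * D"
      using mult_right_mono[OF M\<eta>, of "m * D"] m D by (simp add: \<epsilon>_def mult_ac)
    ultimately have "\<Lambda> * (l1 - l2) - (laplacian u (R x) - laplacian u x) \<le> - (\<Lambda> * c0 / 2) * m * D"
      by (simp add: algebra_simps)
    then have "mixed_operator s u (R x) - mixed_operator s u x \<le> - (\<Lambda> * c0 / 2) * m * D"
      by (simp add: mixed_operator_def frac_laplacian_eq[OF l1] frac_laplacian_eq[OF l2] \<Lambda>_def algebra_simps)
    moreover have "u (R x) < u x" using wx \<epsilon> by (simp add: w_def)
    ultimately show "\<exists>x. x $ k < \<mu> \<and> u (reflect k \<mu> x) < u x \<and>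
        mixed_operator s u (reflect k \<mu> x) - mixed_operator s u x \<le> - (\<Lambda> * c0 / 2) * m * (\<mu> - x $ k) powr (- 2 * s)"
      using xk by (intro exI[of _ x]) (simp add: R_def D_def d_def)
  qed
qed

text \<open>If \<open>0 \<le> u \<le> M\<close>, then \<open>u + (M + 1) |x - p|\<^sup>2\<close> is larger on the unit sphere around \<open>p\<close> than at \<open>p\<close>, so it has
an interior minimum, where a paraboloid of opening independent of \<open>p\<close> touches \<open>u\<close> from below.\<close>

lemma mixed_operator_bounded_above_on_unit_balls:
  fixes u :: "real^'n::finite \<Rightarrow> real"
  assumes s: "0 < s" "s < 1" and u: "u \<in> C2_functions"
    and nonneg: "\<And>x. 0 \<le> u x" and bdd: "bounded (range u)"
    and lim: "\<And>x. \<exists>l. (frac_truncated_integral s u x \<longlongrightarrow> l) (at_right 0)"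
  obtains B where "\<And>p. \<exists>x \<in> ball p 1. mixed_operator s u x \<le> B"
proof -
  obtain C where C: "0 < C" and Cle: "\<And>d a B e (h :: real^'n::finite \<Rightarrow> real).
      \<lbrakk>0 < d; 0 \<le> a; 0 \<le> B; 0 < e; h \<in> borel_measurable borel; bounded (range h);
       \<And>z. norm z < d \<Longrightarrow> h z + h (- z) \<le> 2 * a * (norm z)\<^sup>2; \<And>z. d \<le> norm z \<Longrightarrow> h z \<le> B\<rbrakk>
       \<Longrightarrow> kernel_integral s e h \<le> C * (a * d powr (2 - 2 * s) + B * d powr (- 2 * s))"
    using kernel_integral_le[OF s, where 'n='n] by blast
  obtain M where M: "\<And>y. \<bar>u y\<bar> \<le> M" using bdd by (auto simp: bounded_iff)
  have M0: "0 \<le> M" using M[of 0] by simp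
  have ucont: "continuous_on UNIV u" using u by (simp add: C2_functions_def)
  define a where "a = M + 1"
  have a: "0 < a" using M0 by (simp add: a_def)
  show ?thesis
  proof (rule that)
    fix p :: "real^'n"
    define \<Psi> where "\<Psi> x = u x + a * (norm (x - p))\<^sup>2" for x
    have "continuous_on (cball p 1) \<Psi>" unfolding \<Psi>_def[abs_def]
      by (intro continuous_intros continuous_on_subset[OF ucont]) simp
    then obtain x where x: "x \<in> cball p 1" and xmin: "\<And>y. y \<in> cball p 1 \<Longrightarrow> \<Psi> x \<le> \<Psi> y"
      using continuous_attains_inf[of "cball p 1" \<Psi>] by auto
    have "\<Psi> x \<le> u p" using xmin[of p] by (simp add: \<Psi>_def)
    then have \<Psi>x: "\<Psi> x < a" using M[of p] by (simp add: a_def)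
    have outside: "a \<le> \<Psi> y" if "1 \<le> norm (y - p)" for y
    proof -
      have "1 \<le> (norm (y - p))\<^sup>2" using that by simp
      then have "a * 1 \<le> a * (norm (y - p))\<^sup>2" using a by (intro mult_left_mono) auto
      then show ?thesis using nonneg[of y] by (simp add: \<Psi>_def)
    qed
    have xb: "x \<in> ball p 1" using outside[of x] \<Psi>x by (force simp: dist_norm norm_minus_commute)
    have glob: "\<Psi> x \<le> \<Psi> y" for y
      using xmin[of y] outside[of y] \<Psi>x by (cases "y \<in> cball p 1") (auto simp: dist_norm norm_minus_commute)
    have sym: "(u x - u (x + z)) + (u x - u (x - z)) \<le> 2 * a * (norm z)\<^sup>2" for z
    proof -
      have pg: "(norm (x + z - p))\<^sup>2 + (norm (x - z - p))\<^sup>2 = 2 * (norm (x - p))\<^sup>2 + 2 * (norm z)\<^sup>2"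
        by (simp add: power2_norm_eq_inner inner_diff_left inner_diff_right inner_add_left inner_add_right
            inner_commute algebra_simps)
      have "a * (norm (x + z - p))\<^sup>2 + a * (norm (x - z - p))\<^sup>2 = 2 * (a * (norm (x - p))\<^sup>2) + 2 * a * (norm z)\<^sup>2"
        using arg_cong[OF pg, of "(*) a"] by (simp only: distrib_left mult.left_commute mult.assoc)
      then show ?thesis using glob[of "x + z"] glob[of "x - z"] by (simp add: \<Psi>_def)
    qed
    have ki: "kernel_integral s e (\<lambda>z. u x - u (x + z)) \<le> C * (a + M)" if e: "0 < e" for e
    proof -
      have [measurable]: "u \<in> borel_measurable borel" using ucont by (rule borel_measurable_continuous_onI)
      have "\<bar>u x - u (x + z)\<bar> \<le> 2 * M" for z using M[of x] M[of "x + z"] by linarith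
      then have hb: "bounded (range (\<lambda>z. u x - u (x + z)))" by (auto simp: bounded_iff)
      have "kernel_integral s e (\<lambda>z. u x - u (x + z)) \<le> C * (a * 1 powr (2 - 2 * s) + M * 1 powr (- 2 * s))"
      proof (rule Cle)
        show "u x - u (x + z) \<le> M" for z using M[of x] nonneg[of "x + z"] by linarith
      qed (use a M0 e hb sym in auto)
      then show ?thesis by simp
    qed
    obtain l where l: "(frac_truncated_integral s u x \<longlongrightarrow> l) (at_right 0)" using lim by blast
    have "l \<le> C * (a + M)"
    proof (rule tendsto_upperbound[OF l])
      show "\<forall>\<^sub>F e in at_right 0. frac_truncated_integral s u x e \<le> C * (a + M)"
        by (rule eventually_at_rightI[of 0 1]) (auto simp: frac_truncated_integral_eq_kernel_integral[OF ucont] ki)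
    qed simp
    then have "frac_const CARD('n) s * l \<le> frac_const CARD('n) s * (C * (a + M))"
      using frac_const_pos[OF s] by (intro mult_left_mono) (auto simp: less_imp_le)
    moreover have "- 2 * a * CARD('n) \<le> laplacian u x"
      by (rule laplacian_ge[OF u zero_less_one]) (use sym in \<open>simp add: algebra_simps\<close>)
    ultimately have "mixed_operator s u x \<le> frac_const CARD('n) s * (C * (a + M)) + 2 * a * CARD('n)"
      by (simp add: mixed_operator_def frac_laplacian_eq[OF l])
    then show "\<exists>x\<in>ball p 1. mixed_operator s u x \<le> frac_const CARD('n) s * (C * (a + M)) + 2 * a * CARD('n)"
      using xb by blast
  qed
qed

section \<open>The weight and the nonlinearity\<close>

lemma condition_F2_mono:
  assumes "condition_F2 g" "0 < a" "a \<le> b"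
  shows "g a \<le> g b"
proof -
  have "mono_on {0<..} g" using assms(1) unfolding condition_F2_def by blast
  then show ?thesis using assms(2,3) by (intro mono_onD[of "{0<..}" g]) auto
qed

text \<open>This is where \<open>g'(0) = 0\<close> and the continuity of \<open>g'\<close> at 0 enter.\<close>

lemma condition_F2_small_slope:
  assumes "condition_F2 g" "0 < \<theta>"
  obtains \<eta> where "0 < \<eta>" "\<And>a b. \<lbrakk>0 \<le> a; a \<le> b; b \<le> \<eta>\<rbrakk> \<Longrightarrow> \<bar>g b - g a\<bar> \<le> \<theta> * (b - a)"
proof -
  obtain g' \<delta> where \<delta>: "0 < \<delta>"
    and deriv: "\<And>t. t \<in> {0..<\<delta>} \<Longrightarrow> (g has_real_derivative g' t) (at t within {0..})"
    and cont: "continuous_on {0..<\<delta>} g'" and g'0: "g' 0 = 0"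
    using assms(1) unfolding condition_F2_def by blast
  have "0 \<in> {0..<\<delta>}" using \<delta> by simp
  then obtain \<eta>0 where \<eta>0: "0 < \<eta>0" "\<forall>t\<in>{0..<\<delta>}. dist t 0 < \<eta>0 \<longrightarrow> dist (g' t) (g' 0) < \<theta>"
    using cont assms(2) unfolding continuous_on_iff by meson
  define \<eta> where "\<eta> = min (\<delta> / 2) (\<eta>0 / 2)"
  have \<eta>: "0 < \<eta>" "\<eta> < \<delta>" "\<eta> < \<eta>0" using \<delta> \<eta>0(1) by (auto simp: \<eta>_def min_def)
  show ?thesis
  proof (rule that[OF \<eta>(1)])
    fix a b :: real assume ab: "0 \<le> a" "a \<le> b" "b \<le> \<eta>"
    have "norm (g b - g a) \<le> \<theta> * norm (b - a)"
    proof (rule field_differentiable_bound[of "{0..\<eta>}" g g'])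
      fix t assume t: "t \<in> {0..\<eta>}"
      show "(g has_field_derivative g' t) (at t within {0..\<eta>})"
        by (rule has_field_derivative_subset[OF deriv]) (use t \<eta> in auto)
      show "norm (g' t) \<le> \<theta>" using \<eta>0(2)[rule_format, of t] t \<eta> g'0 by (auto simp: dist_real_def)
    qed (use ab in auto)
    then show "\<bar>g b - g a\<bar> \<le> \<theta> * (b - a)" using ab by simp
  qed
qed

lemma condition_F2_lipschitz:
  assumes g: "condition_F2 g"
  obtains L where "0 < L" "\<And>a b. \<lbrakk>0 \<le> a; a \<le> b; b \<le> M\<rbrakk> \<Longrightarrow> g b - g a \<le> L * (b - a)"
proof -
  obtain \<eta> where \<eta>: "0 < \<eta>" and slope: "\<And>a b. \<lbrakk>0 \<le> a; a \<le> b; b \<le> \<eta>\<rbrakk> \<Longrightarrow> \<bar>g b - g a\<bar> \<le> 1 * (b - a)"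
    using condition_F2_small_slope[OF g zero_less_one] by blast
  have loc: "local_lipschitz {0::real} {0..M} (\<lambda>_. g)"
    unfolding local_lipschitz_def
  proof (intro ballI)
    fix t0 x :: real assume x: "x \<in> {0..M}"
    have "\<exists>r>0. \<exists>L. L-lipschitz_on (cball x r \<inter> {0..M}) g"
    proof (cases "x = 0")
      case True
      have "1-lipschitz_on (cball x \<eta> \<inter> {0..M}) g"
      proof (rule lipschitz_onI)
        fix a b assume "a \<in> cball x \<eta> \<inter> {0..M}" "b \<in> cball x \<eta> \<inter> {0..M}"
        then show "dist (g a) (g b) \<le> 1 * dist a b"
          using slope[of a b] slope[of b a] True by (cases "a \<le> b") (auto simp: dist_real_def)
      qed simp
      then show ?thesis using \<eta> by blast
    next
      case False
      then have "0 < x" using x by simp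
      then obtain r L where r: "0 < r" and L: "L-lipschitz_on (cball x r \<inter> {0<..}) g"
        using g unfolding condition_F2_def by blast
      have "cball x (min r (x / 2)) \<inter> {0..M} \<subseteq> cball x r \<inter> {0<..}"
      proof
        fix y assume y: "y \<in> cball x (min r (x / 2)) \<inter> {0..M}"
        then have "\<bar>x - y\<bar> \<le> r" "\<bar>x - y\<bar> \<le> x / 2" by (auto simp: dist_real_def)
        moreover have "0 < y" using \<open>\<bar>x - y\<bar> \<le> x / 2\<close> \<open>0 < x\<close> by linarith
        ultimately show "y \<in> cball x r \<inter> {0<..}" by (simp add: dist_real_def)
      qed
      then have "L-lipschitz_on (cball x (min r (x / 2)) \<inter> {0..M}) g" by (rule lipschitz_on_subset[OF L])
      then show ?thesis using r \<open>0 < x\<close> by (intro exI[of _ "min r (x / 2)"]) auto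
    qed
    then show "\<exists>r>0. \<exists>L. \<forall>t\<in>cball t0 r \<inter> {0}. L-lipschitz_on (cball x r \<inter> {0..M}) g" by blast
  qed
  obtain L where L: "\<And>t. t \<in> {0::real} \<Longrightarrow> L-lipschitz_on {0..M} g"
    by (rule local_lipschitz_compact_implies_lipschitz[OF loc]) auto
  have "0 \<le> L" using L[of 0] lipschitz_on_nonneg by blast
  show ?thesis
  proof (rule that[of "L + 1"])
    show "0 < L + 1" using \<open>0 \<le> L\<close> by simp
    fix a b assume ab: "0 \<le> a" "a \<le> b" "b \<le> M"
    then have "dist (g b) (g a) \<le> L * dist b a" using L[of 0] by (intro lipschitz_onD) auto
    then have "g b - g a \<le> L * (b - a)" using ab by (simp add: dist_real_def)
    also have "\<dots> \<le> (L + 1) * (b - a)" using ab by (intro mult_right_mono) auto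
    finally show "g b - g a \<le> (L + 1) * (b - a)" .
  qed
qed

lemma condition_F1_at_bot:
  assumes "condition_F1 s f" "0 < \<epsilon>"
  obtains R where "\<And>t. t \<le> - R \<Longrightarrow> f t * \<bar>t\<bar> powr (2 * s) < \<epsilon>"
proof -
  have "Limsup at_bot (\<lambda>t. ereal (f t * \<bar>t\<bar> powr (2 * s))) < ereal \<epsilon>"
    using assms unfolding condition_F1_def by (metis ereal_less(2) le_less_trans)
  then have "\<forall>\<^sub>F t in at_bot. ereal (f t * \<bar>t\<bar> powr (2 * s)) < ereal \<epsilon>" by (rule Limsup_lessD)
  then obtain N where "\<And>t. t \<le> N \<Longrightarrow> f t * \<bar>t\<bar> powr (2 * s) < \<epsilon>"
    by (auto simp: eventually_at_bot_linorder)
  then show ?thesis using that[of "- N"] by simp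
qed

lemma dist_reflect_reflect: "dist (reflect k a x) (reflect k b x) = 2 * \<bar>a - b\<bar>"
proof -
  have "reflect k a x - reflect k b x = (2 * (a - b)) *\<^sub>R axis k 1" by (simp add: reflect_def algebra_simps)
  then show ?thesis by (simp only: dist_norm norm_scaleR norm_axis_1 abs_mult mult_1_right abs_numeral)
qed

lemma dist_reflect_self: "dist (reflect k a x) x = 2 * \<bar>a - x $ k\<bar>"
  by (simp only: dist_norm reflect_def add_diff_cancel_left' norm_scaleR norm_axis_1 abs_mult mult_1_right abs_numeral)

section \<open>Moving planes\<close>

locale bounded_positive_solution =
  fixes s :: real and k :: "'n::finite" and f g :: "real \<Rightarrow> real" and u :: "real^'n \<Rightarrow> real"
  assumes s: "0 < s" "s < 1" and F1: "condition_F1 s f" and F2: "condition_F2 g"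
    and sol: "classical_solution s k f g u" and pos: "\<And>x. 0 < u x"
    and bdd: "bounded (range u)"
begin

lemma C2: "u \<in> C2_functions"
  using sol by (simp add: classical_solution_def)

lemma truncated_limit: "\<exists>l. (frac_truncated_integral s u x \<longlongrightarrow> l) (at_right 0)"
  using sol by (simp add: classical_solution_def)

lemma equation: "mixed_operator s u x = f (x $ k) * g (u x)"
  using sol by (simp add: classical_solution_def mixed_operator_def)

lemma f_strict_mono: "strict_mono f" using F1 by (simp add: condition_F1_def)

lemma g_pos: "0 < t \<Longrightarrow> 0 < g t" using F2 by (simp add: condition_F2_def)

definition order_fails :: "real \<Rightarrow> bool" where
  "order_fails \<nu> \<longleftrightarrow> (\<exists>x. x $ k < \<nu> \<and> u (reflect k \<nu> x) < u x)"

text \<open>What the equation says about \<open>x\<close> when the reflected difference at the plane \<open>x\<^sub>k = \<nu>\<close> has infimum \<open>- m\<close>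
and \<open>x\<close> is a point as provided by the near minimum lemma. The second inequality confines \<open>x\<close>; then
the first makes \<open>g (u (R x))\<close> small when \<open>m\<close> is small, and the third is
contradicted once \<open>g\<close> has small slope between \<open>u (R x)\<close> and \<open>u x\<close>.\<close>

definition contact :: "real \<Rightarrow> real \<Rightarrow> real \<Rightarrow> real \<Rightarrow> real^'n \<Rightarrow> bool" where
  "contact c L \<nu> m x \<longleftrightarrow>
      x $ k < \<nu> \<and> u (reflect k \<nu> x) < u x \<and> u x - u (reflect k \<nu> x) \<le> m \<and> 0 < f (x $ k) \<and>
      (f (2 * \<nu> - x $ k) - f (x $ k)) * g (u (reflect k \<nu> x)) \<le> f (x $ k) * L * m \<and>
      c * (\<nu> - x $ k) powr (- 2 * s) \<le> f (x $ k) * L \<and>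
      c * m * (\<nu> - x $ k) powr (- 2 * s) \<le> f (x $ k) * (g (u x) - g (u (reflect k \<nu> x)))"

text \<open>Here \<open>m\<close> is minus the infimum of the reflected difference, and the clause over \<open>B\<close> records that it is no larger,
which is how uniform continuity will make it small. In
the equation for the reflected difference, the gain of the near minimum lemma and the term with the
jump of \<open>f\<close> are both positive, and their sum is at most \<open>f(x\<^sub>k) (g(u(x)) - g(u(R x)))\<close>. Hence this
quantity and \<open>f(x\<^sub>k)\<close> are positive, and each of the two terms obeys the same bound.\<close>

lemma contact_point:
  obtains c L where "0 < c" "0 < L"
    and "\<And>\<nu>. order_fails \<nu> \<Longrightarrow> \<exists>m>0. \<exists>x. contact c L \<nu> m x \<and>
      (\<forall>B. (\<forall>y. y $ k < \<nu> \<longrightarrow> - B \<le> u (reflect k \<nu> y) - u y) \<longrightarrow> m \<le> B)"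
proof -
  obtain c where c: "0 < c" and touch: "\<And>\<mu> m.
      \<lbrakk>0 < m; \<And>x. x $ k < \<mu> \<Longrightarrow> - m \<le> u (reflect k \<mu> x) - u x;
       \<And>\<eta>. 0 < \<eta> \<Longrightarrow> \<exists>x. x $ k < \<mu> \<and> u (reflect k \<mu> x) - u x < - m + \<eta>\<rbrakk>
      \<Longrightarrow> \<exists>x. x $ k < \<mu> \<and> u (reflect k \<mu> x) < u x \<and>
        mixed_operator s u (reflect k \<mu> x) - mixed_operator s u x \<le> - c * m * (\<mu> - x $ k) powr (- 2 * s)"
    using mixed_operator_reflection_near_minimum[OF s, where 'n='n] C2 bdd truncated_limit by metis
  obtain M where M: "\<And>y. \<bar>u y\<bar> \<le> M" using bdd by (auto simp: bounded_iff)
  obtain L where L: "0 < L" and Lip: "\<And>a b. \<lbrakk>0 \<le> a; a \<le> b; b \<le> M\<rbrakk> \<Longrightarrow> g b - g a \<le> L * (b - a)"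
    using condition_F2_lipschitz[OF F2] by blast
  show ?thesis
  proof (rule that[OF c L])
    fix \<nu> assume bad: "order_fails \<nu>"
    define V where "V = (\<lambda>x. u (reflect k \<nu> x) - u x) ` {x. x $ k < \<nu>}"
    obtain x0 where x0: "x0 $ k < \<nu>" "u (reflect k \<nu> x0) < u x0" using bad by (auto simp: order_fails_def)
    have "- M \<le> u (reflect k \<nu> x) - u x" for x using M[of x] pos[of "reflect k \<nu> x"] by linarith
    then have Vb: "bdd_below V" unfolding V_def by (auto intro!: bdd_belowI[of _ "- M"])
    have Vx0: "u (reflect k \<nu> x0) - u x0 \<in> V" using x0 by (auto simp: V_def)
    define m where "m = - Inf V"
    have "Inf V \<le> u (reflect k \<nu> x0) - u x0" by (rule cInf_lower[OF Vx0 Vb])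
    then have m: "0 < m" using x0 by (simp add: m_def)
    have ge: "- m \<le> u (reflect k \<nu> x) - u x" if "x $ k < \<nu>" for x
      unfolding m_def using cInf_lower[OF _ Vb] that by (auto simp: V_def)
    have inf: "\<exists>x. x $ k < \<nu> \<and> u (reflect k \<nu> x) - u x < - m + \<eta>" if "0 < \<eta>" for \<eta>
    proof -
      have "Inf V < - m + \<eta>" using that by (simp add: m_def)
      moreover have "V \<noteq> {}" using Vx0 by blast
      ultimately obtain v where "v \<in> V" "v < - m + \<eta>" using cInf_lessD by blast
      then show ?thesis by (auto simp: V_def)
    qed
    have least: "m \<le> B" if "\<forall>y. y $ k < \<nu> \<longrightarrow> - B \<le> u (reflect k \<nu> y) - u y" for B
    proof -
      have "- B \<le> Inf V"
        unfolding V_def by (rule cInf_greatest) (use that x0 in auto)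
      then show ?thesis by (simp add: m_def)
    qed
    obtain x where x: "x $ k < \<nu>" "u (reflect k \<nu> x) < u x"
      and op: "mixed_operator s u (reflect k \<nu> x) - mixed_operator s u x \<le> - c * m * (\<nu> - x $ k) powr (- 2 * s)"
      using touch[OF m ge inf] by blast
    have xm: "u x - u (reflect k \<nu> x) \<le> m" using ge[OF x(1)] by simp
    define D where "D = c * m * (\<nu> - x $ k) powr (- 2 * s)"
    define J where "J = (f (2 * \<nu> - x $ k) - f (x $ k)) * g (u (reflect k \<nu> x))"
    define G where "G = g (u x) - g (u (reflect k \<nu> x))"
    have D: "0 < D" using c m x by (simp add: D_def)
    have "f (x $ k) < f (2 * \<nu> - x $ k)" using x by (intro strict_monoD[OF f_strict_mono]) simp
    then have J: "0 < J" unfolding J_def using g_pos[OF pos] by (intro mult_pos_pos) auto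
    have ineq: "D + J \<le> f (x $ k) * G"
      using op by (simp add: D_def J_def G_def equation reflect_nth algebra_simps)
    have "0 \<le> G" unfolding G_def using condition_F2_mono[OF F2 pos, of "reflect k \<nu> x" "u x"] x by simp
    moreover have "0 < f (x $ k) * G" using D J ineq by linarith
    ultimately have fx: "0 < f (x $ k)" by (auto simp: zero_less_mult_iff)
    have "G \<le> L * (u x - u (reflect k \<nu> x))"
      unfolding G_def using x(2) pos[of "reflect k \<nu> x"] M[of x] by (intro Lip) auto
    also have "\<dots> \<le> L * m" using xm L by (intro mult_left_mono) auto
    finally have up: "f (x $ k) * G \<le> f (x $ k) * (L * m)" using fx by (intro mult_left_mono) auto
    have 1: "J \<le> f (x $ k) * L * m" using up D ineq by (simp add: mult.assoc)
    have 2: "D \<le> f (x $ k) * G" using J ineq by linarith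
    have "m * (c * (\<nu> - x $ k) powr (- 2 * s)) \<le> m * (f (x $ k) * L)"
      using 2 up by (simp add: D_def mult_ac)
    then have 3: "c * (\<nu> - x $ k) powr (- 2 * s) \<le> f (x $ k) * L" using m by simp
    have "contact c L \<nu> m x"
      unfolding contact_def using x xm fx 1 2 3 by (simp add: D_def J_def G_def)
    then show "\<exists>m>0. \<exists>x. contact c L \<nu> m x \<and>
      (\<forall>B. (\<forall>y. y $ k < \<nu> \<longrightarrow> - B \<le> u (reflect k \<nu> y) - u y) \<longrightarrow> m \<le> B)"
      using m least by blast
  qed
qed

text \<open>For \<open>x\<^sub>k\<close> far to the left the distance to the plane is at most \<open>2 |x\<^sub>k|\<close>, so the second contact
inequality bounds \<open>f(x\<^sub>k) |x\<^sub>k|\<^bsup>2s\<^esup>\<close> from below, against the decay of \<open>f\<close>.\<close>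

lemma contact_not_far_left:
  assumes "0 < c" "0 < L"
  obtains R where "\<And>\<nu> m x. \<lbrakk>\<nu> \<le> T; contact c L \<nu> m x\<rbrakk> \<Longrightarrow> - R < x $ k"
proof -
  have "0 < c / (4 * L)" using assms by simp
  then obtain R where R: "\<And>t. t \<le> - R \<Longrightarrow> f t * \<bar>t\<bar> powr (2 * s) < c / (4 * L)"
    using condition_F1_at_bot[OF F1] by blast
  show ?thesis
  proof (rule that[of "max R \<bar>T\<bar>"], rule ccontr)
    fix \<nu> m x
    assume \<nu>: "\<nu> \<le> T" and con: "contact c L \<nu> m x" and "\<not> - max R \<bar>T\<bar> < x $ k"
    then have xR: "x $ k \<le> - R" "x $ k \<le> - \<bar>T\<bar>" by auto
    define d where "d = \<nu> - x $ k"
    have fx: "0 < f (x $ k)" and le: "c * d powr (- 2 * s) \<le> f (x $ k) * L" and "x $ k < \<nu>"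
      using con by (auto simp: contact_def d_def)
    then have d: "0 < d" "d \<le> 2 * \<bar>x $ k\<bar>" using xR \<nu> by (auto simp: d_def)
    have "d powr (2 * s) \<le> (2 * \<bar>x $ k\<bar>) powr (2 * s)" using d s by (intro powr_mono2) auto
    also have "\<dots> = 2 powr (2 * s) * \<bar>x $ k\<bar> powr (2 * s)" by (simp add: powr_mult)
    also have "\<dots> \<le> 4 * \<bar>x $ k\<bar> powr (2 * s)"
      using powr_mono[of "2 * s" 2 2] s by (intro mult_right_mono) auto
    finally have d4: "d powr (2 * s) \<le> 4 * \<bar>x $ k\<bar> powr (2 * s)" .
    have "c = c * d powr (- 2 * s) * d powr (2 * s)" using d by (simp add: powr_add[symmetric] mult.assoc)
    also have "\<dots> \<le> f (x $ k) * L * d powr (2 * s)" using le by (intro mult_right_mono) auto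
    also have "\<dots> \<le> f (x $ k) * L * (4 * \<bar>x $ k\<bar> powr (2 * s))"
      using d4 fx assms by (intro mult_left_mono) auto
    also have "\<dots> = 4 * L * (f (x $ k) * \<bar>x $ k\<bar> powr (2 * s))" by simp
    also have "\<dots> < 4 * L * (c / (4 * L))" using R[OF xR(1)] assms by (intro mult_strict_left_mono) auto
    also have "\<dots> = c" using assms by simp
    finally show False by simp
  qed
qed

lemma order_holds_far_left: "\<exists>\<tau>. \<forall>\<nu>\<le>\<tau>. \<not> order_fails \<nu>"
proof -
  obtain c L where cL: "0 < c" "0 < L"
    and con: "\<And>\<nu>. order_fails \<nu> \<Longrightarrow> \<exists>m>0. \<exists>x. contact c L \<nu> m x \<and>
      (\<forall>B. (\<forall>y. y $ k < \<nu> \<longrightarrow> - B \<le> u (reflect k \<nu> y) - u y) \<longrightarrow> m \<le> B)"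
    using contact_point by metis
  obtain R where R: "\<And>\<nu> m x. \<lbrakk>\<nu> \<le> 0; contact c L \<nu> m x\<rbrakk> \<Longrightarrow> - R < x $ k"
    using contact_not_far_left[OF cL, of 0] by metis
  have "\<not> order_fails \<nu>" if "\<nu> \<le> min 0 (- R)" for \<nu>
  proof
    assume "order_fails \<nu>"
    then obtain m x where x: "contact c L \<nu> m x" using con by blast
    then have "- R < x $ k" using R that by auto
    then show False using x that by (simp add: contact_def)
  qed
  then show ?thesis by blast
qed

text \<open>The planes do not get stuck. Every constant is fixed before the position \<open>\<tau>\<close> of the plane is chosen:
\<open>\<delta>0\<close> bounds the distance of a contact point from the plane from below and \<open>d1\<close> from above, \<open>\<kappa>\<close> is
the resulting jump of \<open>f\<close>, and \<open>B\<close> is a bound on \<open>m\<close> that makes \<open>u\<close> at most \<open>\<eta>1\<close> at a contact point,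
below which the slope of \<open>g\<close> is at most \<open>\<theta>\<close>.\<close>

lemma order_extends_to_the_right:
  assumes uc: "uniformly_continuous_on UNIV u" and below: "\<And>\<tau>. \<tau> < \<mu> \<Longrightarrow> \<not> order_fails \<tau>"
  obtains \<eta> where "0 < \<eta>" "\<And>\<tau>. \<lbrakk>\<mu> \<le> \<tau>; \<tau> \<le> \<mu> + \<eta>\<rbrakk> \<Longrightarrow> \<not> order_fails \<tau>"
proof -
  obtain c L where c: "0 < c" and L: "0 < L"
    and con: "\<And>\<nu>. order_fails \<nu> \<Longrightarrow> \<exists>m>0. \<exists>x. contact c L \<nu> m x \<and>
      (\<forall>B. (\<forall>y. y $ k < \<nu> \<longrightarrow> - B \<le> u (reflect k \<nu> y) - u y) \<longrightarrow> m \<le> B)"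
    using contact_point by metis
  obtain R where R: "\<And>\<nu> m x. \<lbrakk>\<nu> \<le> \<mu> + 1; contact c L \<nu> m x\<rbrakk> \<Longrightarrow> - R < x $ k"
    using contact_not_far_left[OF c L, of "\<mu> + 1"] by metis
  have fmono: "f a \<le> f b" if "a \<le> b" for a b
    using strict_mono_mono[OF f_strict_mono] that by (rule monoD)
  define F where "F = max 1 (f (\<mu> + 1))"
  have F: "0 < F" by (simp add: F_def)
  \<comment> \<open>Chosen such that \<open>c * \<delta>0 powr (- 2 * s)\<close> exceeds \<open>F * L\<close>, the largest value that the second contact
    inequality permits.\<close>
  define \<delta>0 where "\<delta>0 = (F * L / c + 1) powr (- 1 / (2 * s))"
  have "0 < F * L / c" using F L c by simp
  then have \<delta>0: "0 < \<delta>0" "\<delta>0 powr (- 2 * s) = F * L / c + 1"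
    using s by (auto simp: \<delta>0_def powr_powr)
  define \<kappa> where "\<kappa> = f (\<mu> + \<delta>0) - f \<mu>"
  have \<kappa>: "0 < \<kappa>" using \<delta>0 strict_monoD[OF f_strict_mono, of \<mu> "\<mu> + \<delta>0"] by (simp add: \<kappa>_def)
  define d1 where "d1 = max 1 (\<mu> + 1 + R)"
  have d1: "0 < d1" by (simp add: d1_def)
  \<comment> \<open>Half of what would be needed for the third contact inequality.\<close>
  define \<theta> where "\<theta> = c * d1 powr (- 2 * s) / (2 * F)"
  have \<theta>: "0 < \<theta>" using c d1 F by (simp add: \<theta>_def)
  obtain \<eta>1 where \<eta>1: "0 < \<eta>1"
    and slope: "\<And>a b. \<lbrakk>0 \<le> a; a \<le> b; b \<le> \<eta>1\<rbrakk> \<Longrightarrow> \<bar>g b - g a\<bar> \<le> \<theta> * (b - a)"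
    using condition_F2_small_slope[OF F2 \<theta>] by blast
  define B where "B = min (\<eta>1 / 2) (\<kappa> * g (\<eta>1 / 2) / (2 * F * L))"
  have g\<eta>: "0 < g (\<eta>1 / 2)" using \<eta>1 by (intro g_pos) simp
  have B: "0 < B" using \<eta>1 \<kappa> F L g\<eta> by (simp add: B_def)
  have BF: "F * L * B < \<kappa> * g (\<eta>1 / 2)"
  proof -
    have "F * L * B \<le> F * L * (\<kappa> * g (\<eta>1 / 2) / (2 * F * L))" using F L by (intro mult_left_mono) (auto simp: B_def)
    also have "\<dots> = \<kappa> * g (\<eta>1 / 2) / 2" using F L by simp
    also have "\<dots> < \<kappa> * g (\<eta>1 / 2)" using \<kappa> g\<eta> by simp
    finally show ?thesis .
  qed
  obtain \<rho> where \<rho>: "0 < \<rho>" "\<And>y z. dist y z < \<rho> \<Longrightarrow> dist (u y) (u z) < B"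
    using uc B unfolding uniformly_continuous_on_def by (metis UNIV_I)
  \<comment> \<open>With \<open>\<tau> - (\<mu> - \<eta>) \<le> 2 * \<eta>\<close>, the reflections at the two planes differ by at most \<open>4 * \<eta> < \<rho>\<close>.\<close>
  define \<eta> where "\<eta> = min (min 1 \<delta>0) (\<rho> / 8)"
  have \<eta>: "0 < \<eta>" "\<eta> \<le> 1" "\<eta> \<le> \<delta>0" "\<eta> \<le> \<rho> / 8" using \<delta>0 \<rho> by (auto simp: \<eta>_def)
  show ?thesis
  proof (rule that[OF \<eta>(1)], rule notI)
    fix \<tau> assume \<tau>: "\<mu> \<le> \<tau>" "\<tau> \<le> \<mu> + \<eta>" "order_fails \<tau>"
    obtain m x where m: "0 < m" and least: "\<forall>B. (\<forall>y. y $ k < \<tau> \<longrightarrow> - B \<le> u (reflect k \<tau> y) - u y) \<longrightarrow> m \<le> B"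
      and conx: "contact c L \<tau> m x"
      using con[OF \<tau>(3)] by blast
    define d where "d = \<tau> - x $ k"
    have x: "x $ k < \<tau>" "u (reflect k \<tau> x) < u x" "u x - u (reflect k \<tau> x) \<le> m" "0 < f (x $ k)"
      and jump: "(f (2 * \<tau> - x $ k) - f (x $ k)) * g (u (reflect k \<tau> x)) \<le> f (x $ k) * L * m"
      and dist: "c * d powr (- 2 * s) \<le> f (x $ k) * L"
      and op: "c * m * d powr (- 2 * s) \<le> f (x $ k) * (g (u x) - g (u (reflect k \<tau> x)))"
      using conx by (auto simp: contact_def d_def)
    have mB: "m \<le> B"
    proof (rule least[rule_format])
      fix y :: "real^'n" assume y: "y $ k < \<tau>"
      show "- B \<le> u (reflect k \<tau> y) - u y"
      \<comment> \<open>Compare with the plane at \<open>\<mu> - \<eta>\<close>, where the order holds; points between the two planes are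
        moved by less than \<open>\<rho>\<close>.\<close>
      proof (cases "y $ k < \<mu> - \<eta>")
        case True
        have "dist (u (reflect k \<tau> y)) (u (reflect k (\<mu> - \<eta>) y)) < B"
          by (rule \<rho>(2)) (use \<tau> \<eta> \<rho> in \<open>simp add: dist_reflect_reflect\<close>)
        moreover have "u y \<le> u (reflect k (\<mu> - \<eta>) y)"
          using below[of "\<mu> - \<eta>"] \<eta> True by (force simp: order_fails_def)
        ultimately show ?thesis by (simp add: dist_real_def)
      next
        case False
        have "dist (u (reflect k \<tau> y)) (u y) < B"
          by (rule \<rho>(2)) (use \<tau> \<eta> \<rho> y False in \<open>simp add: dist_reflect_self\<close>)
        then show ?thesis by (simp add: dist_real_def)
      qed
    qed
    have "x $ k \<le> \<mu> + 1" using x \<tau> \<eta> by linarith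
    then have fF: "f (x $ k) \<le> F" using fmono[of "x $ k" "\<mu> + 1"] by (simp add: F_def)
    have d: "0 < d" using x by (simp add: d_def)
    have dl: "\<delta>0 \<le> d"
    proof (rule ccontr)
      assume "\<not> \<delta>0 \<le> d"
      then have "\<delta>0 powr (- 2 * s) \<le> d powr (- 2 * s)" using d s by (intro powr_mono2') auto
      then have "c * (F * L / c + 1) \<le> c * d powr (- 2 * s)" using \<delta>0 c by (intro mult_left_mono) auto
      also have "\<dots> \<le> f (x $ k) * L" by (rule dist)
      also have "\<dots> \<le> F * L" using fF L by (intro mult_right_mono) auto
      finally show False using c by (simp add: distrib_left)
    qed
    have "- R < x $ k" using R[OF _ conx] \<tau> \<eta> by simp
    then have du: "d \<le> d1" using \<tau> \<eta> by (auto simp: d_def d1_def)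
    have "f (\<mu> + \<delta>0) \<le> f (2 * \<tau> - x $ k)" using dl \<tau> by (intro fmono) (auto simp: d_def)
    moreover have "f (x $ k) \<le> f \<mu>" using dl \<tau> \<eta> by (intro fmono) (auto simp: d_def)
    ultimately have "\<kappa> \<le> f (2 * \<tau> - x $ k) - f (x $ k)" by (simp add: \<kappa>_def)
    then have "\<kappa> * g (u (reflect k \<tau> x)) \<le> (f (2 * \<tau> - x $ k) - f (x $ k)) * g (u (reflect k \<tau> x))"
      using g_pos[OF pos] by (intro mult_right_mono) (auto simp: less_imp_le)
    also have "\<dots> \<le> f (x $ k) * L * m" by (rule jump)
    also have "\<dots> \<le> F * L * B" using fF L mB m F by (intro mult_mono) auto
    also have "\<dots> < \<kappa> * g (\<eta>1 / 2)" by (rule BF)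
    finally have "g (u (reflect k \<tau> x)) < g (\<eta>1 / 2)" using \<kappa> by simp
    then have "u (reflect k \<tau> x) < \<eta>1 / 2"
      using condition_F2_mono[OF F2, of "\<eta>1 / 2" "u (reflect k \<tau> x)"] \<eta>1 by force
    then have ux: "u x \<le> \<eta>1" using x(3) mB by (simp add: B_def)
    have "\<bar>g (u x) - g (u (reflect k \<tau> x))\<bar> \<le> \<theta> * (u x - u (reflect k \<tau> x))"
      using pos[of "reflect k \<tau> x"] x ux by (intro slope) auto
    also have "\<dots> \<le> \<theta> * m" using \<theta> x by (intro mult_left_mono) auto
    finally have "g (u x) - g (u (reflect k \<tau> x)) \<le> \<theta> * m" by simp
    then have "f (x $ k) * (g (u x) - g (u (reflect k \<tau> x))) \<le> f (x $ k) * (\<theta> * m)"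
      using x by (intro mult_left_mono) auto
    also have "\<dots> \<le> F * (\<theta> * m)" using fF \<theta> m by (intro mult_right_mono) auto
    also have "\<dots> = c * m * d1 powr (- 2 * s) / 2" using F by (simp add: \<theta>_def)
    also have "\<dots> < c * m * d1 powr (- 2 * s)" using c m d1 by simp
    also have "\<dots> \<le> c * m * d powr (- 2 * s)"
      using c m d du s by (intro mult_left_mono powr_mono2') auto
    finally show False using op by simp
  qed
qed

lemma order_never_fails:
  assumes uc: "uniformly_continuous_on UNIV u"
  shows "\<not> order_fails \<nu>"
proof
  assume bad: "order_fails \<nu>"
  define S where "S = {\<tau>. \<forall>\<nu>\<le>\<tau>. \<not> order_fails \<nu>}"
  have S0: "S \<noteq> {}" using order_holds_far_left by (auto simp: S_def)
  have Sb: "bdd_above S"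
  proof (rule bdd_aboveI)
    fix \<tau> assume "\<tau> \<in> S" then show "\<tau> \<le> \<nu>" using bad unfolding S_def by (metis (mono_tags, lifting) linear mem_Collect_eq)
  qed
  have below: "\<not> order_fails \<tau>" if less: "\<tau> < Sup S" for \<tau>
  proof -
    obtain \<sigma> where "\<sigma> \<in> S" "\<tau> < \<sigma>" using less_cSupE[OF less S0] by metis
    then show ?thesis unfolding S_def using less_imp_le by blast
  qed
  obtain \<eta> where \<eta>: "0 < \<eta>" "\<And>\<tau>. \<lbrakk>Sup S \<le> \<tau>; \<tau> \<le> Sup S + \<eta>\<rbrakk> \<Longrightarrow> \<not> order_fails \<tau>"
    using order_extends_to_the_right[OF uc below] by metis
  have "\<not> order_fails \<tau>" if "\<tau> \<le> Sup S + \<eta>" for \<tau>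
    using below[of \<tau>] \<eta>(2)[of \<tau>] that by linarith
  then have "Sup S + \<eta> \<in> {\<tau>. \<forall>\<nu>\<le>\<tau>. \<not> order_fails \<nu>}" by blast
  then have "Sup S + \<eta> \<in> S" by (simp only: S_def)
  then have "Sup S + \<eta> \<le> Sup S" by (rule cSup_upper[OF _ Sb])
  then show False using \<eta>(1) by simp
qed

lemma monotone_in_direction:
  assumes uc: "uniformly_continuous_on UNIV u" and "0 \<le> t"
  shows "u x \<le> u (x + t *\<^sub>R axis k 1)"
proof (cases "t = 0")
  case False
  have "reflect k (x $ k + t / 2) x = x + t *\<^sub>R axis k 1" by (simp add: reflect_def)
  moreover have "x $ k < x $ k + t / 2" using False assms(2) by simp
  ultimately show ?thesis
    using order_never_fails[OF uc, of "x $ k + t / 2"] unfolding order_fails_def by (metis not_less)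
qed simp

end

section \<open>Nonexistence of bounded positive solutions\<close>

theorem theorem1p3:
  fixes f g :: "real \<Rightarrow> real" and s :: real and k :: "'n::finite"
  assumes "0 < s" and "s < 1"
    and "condition_F1 s f"
    and "condition_F2 g"
    and "filterlim f at_top at_top"
  shows "\<not> (\<exists>u :: real^'n \<Rightarrow> real.
           classical_solution s k f g u \<and> (\<forall>x. u x > 0) \<and>
           bounded (range u) \<and> uniformly_continuous_on UNIV u)"
proof
  assume "\<exists>u :: real^'n \<Rightarrow> real. classical_solution s k f g u \<and> (\<forall>x. u x > 0) \<and>
           bounded (range u) \<and> uniformly_continuous_on UNIV u"
  then obtain u :: "real^'n \<Rightarrow> real" where sol: "classical_solution s k f g u" and pos: "\<And>x. 0 < u x"
    and bdd: "bounded (range u)" and uc: "uniformly_continuous_on UNIV u" by blast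
  interpret bounded_positive_solution s k f g u
    by unfold_locales (use assms sol pos bdd in auto)
  have "continuous_on (cball 0 1) u" using C2 by (auto simp: C2_functions_def intro: continuous_on_subset)
  then obtain x0 where x0: "\<And>y. y \<in> cball 0 1 \<Longrightarrow> u x0 \<le> u y"
    using continuous_attains_inf[of "cball 0 1" u] by (metis cball_eq_empty compact_cball not_one_less_zero)
  have g0: "0 < g (u x0)" by (intro g_pos pos)
  obtain B where B: "\<And>p. \<exists>x \<in> ball p 1. mixed_operator s u x \<le> B"
    using mixed_operator_bounded_above_on_unit_balls[OF s C2 _ bdd truncated_limit] pos less_imp_le by metis
  have "\<forall>\<^sub>F t in at_top. (\<bar>B\<bar> + 1) / g (u x0) \<le> f t"
    using assms(5) by (simp add: filterlim_at_top)
  then obtain T where T: "\<And>t. T \<le> t \<Longrightarrow> (\<bar>B\<bar> + 1) / g (u x0) \<le> f t"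
    by (auto simp: eventually_at_top_linorder)
  define t where "t = max 0 (T + 1)"
  obtain x where x: "x \<in> ball (t *\<^sub>R axis k 1) 1" "mixed_operator s u x \<le> B" using B by blast
  have xt: "norm (x - t *\<^sub>R axis k 1) < 1" using x(1) by (simp add: dist_norm norm_minus_commute)
  have "\<bar>(x - t *\<^sub>R axis k 1) $ k\<bar> \<le> norm (x - t *\<^sub>R axis k 1)" by (rule component_le_norm_cart)
  then have "\<bar>x $ k - t\<bar> < 1" using xt by (simp add: axis_def)
  then have "T \<le> x $ k" by (simp add: t_def)
  then have f: "(\<bar>B\<bar> + 1) / g (u x0) \<le> f (x $ k)" by (rule T)
  have "u x0 \<le> u (x - t *\<^sub>R axis k 1)" using xt by (intro x0) simp
  also have "\<dots> \<le> u x" using monotone_in_direction[OF uc, of t "x - t *\<^sub>R axis k 1"] by (simp add: t_def)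
  finally have "g (u x0) \<le> g (u x)" by (intro condition_F2_mono[OF F2] pos)
  moreover have "0 \<le> (\<bar>B\<bar> + 1) / g (u x0)" using g0 by simp
  then have "0 \<le> f (x $ k)" using f by linarith
  ultimately have "(\<bar>B\<bar> + 1) / g (u x0) * g (u x0) \<le> f (x $ k) * g (u x)"
    using f g0 by (intro mult_mono) auto
  then have "\<bar>B\<bar> + 1 \<le> B" using g0 x(2) by (simp add: equation)
  then show False by linarith
qed

end
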